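(* Let $\Gamma$ be a finitely generated group and let $(\Gamma,\Lambda)$ be a Hecke pair with engulfing triple $(E,\rho,\Delta)$. Then there exist a locally compact group $G$ and a virtual uniform lattice embedding $\gamma:\Gamma\to G$ such that $G$ fits into a short exact sequence $1\to E\xrightarrow{p}G\xrightarrow{q}Q\to1$ and: (1) $(Q,\lambda)$ is the Schlichting completion of $(\Gamma,\Lambda_0)$ for some finite index subgroup $\Lambda_0\le\Lambda$; (2) $p$ is a topological embedding and $q$ is a topological quotient map; (3) $\lambda=q\circ\gamma$; (4) for all $g\in\Gamma$ and $v\in E$, $p(\Delta(g)(v))=\gamma(g)p(v)\gamma(g)^{-1}$.
   Context: A Hecke pair $(\Gamma,\Lambda)$ is a group $\Gamma$ with a commensurated subgroup $\Lambda$ (i.e. $g\Lambda g^{-1}\cap\Lambda$ has finite index in both for all $g$). A homomorphism from a discrete group to a locally compact group is a virtual uniform lattice embedding if it has finite kernel and its image is a uniform (discrete cocompact) lattice. An engulfing triple $(E,\rho,\Delta)$ of $(\Gamma,\Lambda)$ consists of a locally compact group $E$, a virtual uniform lattice embedding $\rho:\Lambda\to E$ and a homomorphism $\Delta:\Gamma\to\mathrm{Aut}(E)$ such that (i) $\Delta|_\Lambda$ equals $h\mapsto(e\mapsto\rho(h)e\rho(h)^{-1})$, and (ii) for every $g\in\Gamma$ there is a finite index subgroup $\Lambda_g\le\Lambda$ with $\Delta(g)(\rho(h))=\rho(ghg^{-1})$ for all $h\in\Lambda_g$. The Schlichting completion of a Hecke pair $(\Gamma,\Lambda)$ is $(Q,\lambda)$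 where $Q$ is the closure of the image of the left-multiplication action $\Gamma\to\mathrm{Sym}(\Gamma/\Lambda)$ in the topology of pointwise convergence, and $\lambda:\Gamma\to Q$ is the induced map. *)

theory Defs
  imports "HOL-Analysis.Analysis" "HOL-Algebra.Algebra"
begin

definition topological_group :: "('a, 'b) monoid_scheme \<Rightarrow> 'a topology \<Rightarrow> bool" where
  "topological_group G T \<longleftrightarrow> group G \<and> topspace T = carrier G \<and>
     continuous_map (prod_topology T T) T (\<lambda>(x, y). x \<otimes>\<^bsub>G\<^esub> y) \<and>
     continuous_map T T (\<lambda>x. inv\<^bsub>G\<^esub> x)"

text \<open>Locally compact groups are taken to be Hausdorff (standard convention).\<close>
definition locally_compact_group :: "('a, 'b) monoid_scheme \<Rightarrow> 'a topology \<Rightarrow> bool" where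
  "locally_compact_group G T \<longleftrightarrow> topological_group G T \<and> Hausdorff_space T \<and>
     locally_compact_space T"

definition coset_space_topology :: "('a, 'b) monoid_scheme \<Rightarrow> 'a topology \<Rightarrow> 'a set \<Rightarrow> 'a set topology" where
  "coset_space_topology G T H = topology (\<lambda>U. U \<subseteq> lcosets\<^bsub>G\<^esub> H \<and> openin T (\<Union>U))"

definition uniform_lattice :: "('a, 'b) monoid_scheme \<Rightarrow> 'a topology \<Rightarrow> 'a set \<Rightarrow> bool" where
  "uniform_lattice G T H \<longleftrightarrow> subgroup H G \<and>
     (\<forall>x\<in>H. openin (subtopology T H) {x}) \<and>
     compact_space (coset_space_topology G T H)"

definition virtual_uniform_lattice_embedding ::
  "('a, 'b) monoid_scheme \<Rightarrow> ('c, 'd) monoid_scheme \<Rightarrow> 'c topology \<Rightarrow> ('a \<Rightarrow> 'c) \<Rightarrow> bool" where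
  "virtual_uniform_lattice_embedding L G T f \<longleftrightarrow> f \<in> hom L G \<and>
     finite {x \<in> carrier L. f x = \<one>\<^bsub>G\<^esub>} \<and> uniform_lattice G T (f ` carrier L)"

definition finite_index_subgroup :: "('a, 'b) monoid_scheme \<Rightarrow> 'a set \<Rightarrow> 'a set \<Rightarrow> bool" where
  "finite_index_subgroup G H K \<longleftrightarrow> subgroup H G \<and> H \<subseteq> K \<and>
     finite {k <#\<^bsub>G\<^esub> H | k. k \<in> K}"

definition conj_set :: "('a, 'b) monoid_scheme \<Rightarrow> 'a \<Rightarrow> 'a set \<Rightarrow> 'a set" where
  "conj_set G g H = (\<lambda>h. g \<otimes>\<^bsub>G\<^esub> h \<otimes>\<^bsub>G\<^esub> inv\<^bsub>G\<^esub> g) ` H"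

definition hecke_pair :: "('a, 'b) monoid_scheme \<Rightarrow> 'a set \<Rightarrow> bool" where
  "hecke_pair G L \<longleftrightarrow> group G \<and> subgroup L G \<and>
     (\<forall>g\<in>carrier G. finite_index_subgroup G (conj_set G g L \<inter> L) L \<and>
                     finite_index_subgroup G (conj_set G g L \<inter> L) (conj_set G g L))"

definition finitely_generated_group :: "('a, 'b) monoid_scheme \<Rightarrow> bool" where
  "finitely_generated_group G \<longleftrightarrow> group G \<and>
     (\<exists>S. finite S \<and> S \<subseteq> carrier G \<and> generate G S = carrier G)"

definition top_aut :: "('a, 'b) monoid_scheme \<Rightarrow> 'a topology \<Rightarrow> ('a \<Rightarrow> 'a) set" where
  "top_aut E T = {f. f \<in> hom E E \<and> bij_betw f (carrier E) (carrier E) \<and> homeomorphic_map T T f}"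

definition aut_action :: "('a, 'b) monoid_scheme \<Rightarrow> ('e, 'f) monoid_scheme \<Rightarrow> 'e topology \<Rightarrow> ('a \<Rightarrow> 'e \<Rightarrow> 'e) \<Rightarrow> bool" where
  "aut_action G E T D \<longleftrightarrow> (\<forall>g\<in>carrier G. D g \<in> top_aut E T) \<and>
     (\<forall>g\<in>carrier G. \<forall>h\<in>carrier G. \<forall>v\<in>carrier E. D (g \<otimes>\<^bsub>G\<^esub> h) v = D g (D h v))"

definition engulfing_triple ::
  "('a, 'b) monoid_scheme \<Rightarrow> 'a set \<Rightarrow> ('e, 'f) monoid_scheme \<Rightarrow> 'e topology \<Rightarrow>
   ('a \<Rightarrow> 'e) \<Rightarrow> ('a \<Rightarrow> 'e \<Rightarrow> 'e) \<Rightarrow> bool" where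
  "engulfing_triple G L E T rho D \<longleftrightarrow>
     locally_compact_group E T \<and>
     virtual_uniform_lattice_embedding (G\<lparr>carrier := L\<rparr>) E T rho \<and>
     aut_action G E T D \<and>
     (\<forall>h\<in>L. \<forall>v\<in>carrier E. D h v = rho h \<otimes>\<^bsub>E\<^esub> v \<otimes>\<^bsub>E\<^esub> inv\<^bsub>E\<^esub> (rho h)) \<and>
     (\<forall>g\<in>carrier G. \<exists>Lg. finite_index_subgroup G Lg L \<and>
        (\<forall>h\<in>Lg. g \<otimes>\<^bsub>G\<^esub> h \<otimes>\<^bsub>G\<^esub> inv\<^bsub>G\<^esub> g \<in> L \<and>
                 D g (rho h) = rho (g \<otimes>\<^bsub>G\<^esub> h \<otimes>\<^bsub>G\<^esub> inv\<^bsub>G\<^esub> g)))"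

text \<open>Permutations of G/L are represented as extensional functions on the coset set
  (value undefined outside).  Sym(G/L) carries the topology of pointwise convergence
  (product of discrete topologies).\<close>
definition sym_cosets :: "('a, 'b) monoid_scheme \<Rightarrow> 'a set \<Rightarrow> ('a set \<Rightarrow> 'a set) set" where
  "sym_cosets G L = {f \<in> (lcosets\<^bsub>G\<^esub> L) \<rightarrow>\<^sub>E (lcosets\<^bsub>G\<^esub> L).
                      bij_betw f (lcosets\<^bsub>G\<^esub> L) (lcosets\<^bsub>G\<^esub> L)}"

definition sym_topology :: "('a, 'b) monoid_scheme \<Rightarrow> 'a set \<Rightarrow> ('a set \<Rightarrow> 'a set) topology" where
  "sym_topology G L = subtopology
     (product_topology (\<lambda>_. discrete_topology (lcosets\<^bsub>G\<^esub> L)) (lcosets\<^bsub>G\<^esub> L))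
     (sym_cosets G L)"

definition schlichting_map :: "('a, 'b) monoid_scheme \<Rightarrow> 'a set \<Rightarrow> 'a \<Rightarrow> ('a set \<Rightarrow> 'a set)" where
  "schlichting_map G L g = restrict (\<lambda>C. g <#\<^bsub>G\<^esub> C) (lcosets\<^bsub>G\<^esub> L)"

definition schlichting_group :: "('a, 'b) monoid_scheme \<Rightarrow> 'a set \<Rightarrow> ('a set \<Rightarrow> 'a set) monoid" where
  "schlichting_group G L =
     \<lparr>carrier = (sym_topology G L) closure_of (schlichting_map G L ` carrier G),
      mult = (\<lambda>f g. restrict (f \<circ> g) (lcosets\<^bsub>G\<^esub> L)),
      one = restrict id (lcosets\<^bsub>G\<^esub> L)\<rparr>"

definition schlichting_topology :: "('a, 'b) monoid_scheme \<Rightarrow> 'a set \<Rightarrow> ('a set \<Rightarrow> 'a set) topology" where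
  "schlichting_topology G L = subtopology (sym_topology G L) (carrier (schlichting_group G L))"

end

theory Submission
  imports Defs
begin

text \<open>
  Let \<open>L\<close> be the intersection of \<open>\<Lambda>\<close> with the groups \<open>\<Lambda>\<^sub>a\<close>, \<open>a\<close> running over a finite generating
  set. Induction on word length shows that for every \<open>g\<close> the relation
  \<open>\<Delta> g (\<rho> (inv g \<otimes> u \<otimes> g)) = \<rho> u\<close> holds for all \<open>u\<close> fixing a suitable finite set of cosets in
  \<open>\<Gamma>/L\<close>. Choose representatives \<open>rep C\<close> of the cosets and put
  \<open>t h C = \<Delta> (rep (hC)) (\<rho> (inv (rep (hC)) \<otimes> h \<otimes> rep C))\<close>. Then \<open>t\<close> is a cocycle for the action of \<open>\<Gamma>\<close>
  on \<open>\<Gamma>/L\<close>, and by the relation above the quotient \<open>\<sigma> h C = inv (t h L) \<otimes> t h C\<close> depends only on the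
  values of \<open>h\<close> on finitely many cosets. Hence \<open>\<sigma>\<close> extends to a locally constant function on the
  Schlichting completion \<open>Q\<close> of \<open>(\<Gamma>, L)\<close>, where \<open>(x, y) \<mapsto> \<sigma> x (y L)\<close> is a factor set with respect
  to the automorphisms \<open>\<Delta> (rep (x L))\<close>. The group \<open>G\<close> is the resulting extension of \<open>Q\<close> by \<open>E\<close> on the
  product space \<open>E \<times> Q\<close>, and \<open>\<gamma> g = (t g L, \<lambda> g)\<close>. The fibres of \<open>\<gamma>\<close> over small sets in
  \<open>E \<times> {x. x L = g L}\<close> are translates of subsets of the finite kernel of \<open>\<rho>\<close>, which gives
  discreteness; a compact set \<open>M\<close> with \<open>M \<rho>(L) = E\<close> and the compact stabiliser \<open>K\<close> of \<open>L\<close> in \<open>Q\<close>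
  give \<open>(M \<times> K) \<gamma>(\<Gamma>) = G\<close>.
\<close>

section \<open>Extensions given by a factor set\<close>

text \<open>The pair \<open>(v, x)\<close> stands for \<open>v s(x)\<close>, where \<open>s\<close>
  is a set-theoretic section of the projection to \<open>Q\<close> with
  \<open>s(x) s(y) = f x y s(xy)\<close>, and \<open>D x\<close> is conjugation by
  \<open>s(x)\<close>.\<close>

definition twisted_product ::
  "('e, 'f) monoid_scheme \<Rightarrow> ('q, 'r) monoid_scheme \<Rightarrow> ('q \<Rightarrow> 'e \<Rightarrow> 'e) \<Rightarrow> ('q \<Rightarrow> 'q \<Rightarrow> 'e)
    \<Rightarrow> ('e \<times> 'q) monoid" where
  "twisted_product E Q D f =
     \<lparr>carrier = carrier E \<times> carrier Q,
      mult = (\<lambda>(v, x) (w, y). (v \<otimes>\<^bsub>E\<^esub> D x w \<otimes>\<^bsub>E\<^esub> f x y, x \<otimes>\<^bsub>Q\<^esub> y)),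
      one = (\<one>\<^bsub>E\<^esub>, \<one>\<^bsub>Q\<^esub>)\<rparr>"

text \<open>With this reading \<open>D_twist\<close> compares conjugation by
  \<open>s(x) s(y)\<close> with conjugation by \<open>f x y s(xy)\<close>, and
  \<open>f_cocycle\<close> compares the two bracketings of \<open>s(x) s(y) s(z)\<close>. The
  conditions at the identity express \<open>s(1) = 1\<close>.\<close>

locale factor_set = E: group E + Q: group Q
  for E :: "('e, 'f) monoid_scheme" and Q :: "('q, 'r) monoid_scheme" +
  fixes D :: "'q \<Rightarrow> 'e \<Rightarrow> 'e" and f :: "'q \<Rightarrow> 'q \<Rightarrow> 'e"
  assumes D_hom: "x \<in> carrier Q \<Longrightarrow> D x \<in> hom E E"
    and f_closed [simp]: "x \<in> carrier Q \<Longrightarrow> y \<in> carrier Q \<Longrightarrow> f x y \<in> carrier E"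
    and D_one [simp]: "v \<in> carrier E \<Longrightarrow> D \<one>\<^bsub>Q\<^esub> v = v"
    and f_one_left [simp]: "y \<in> carrier Q \<Longrightarrow> f \<one>\<^bsub>Q\<^esub> y = \<one>\<^bsub>E\<^esub>"
    and f_one_right [simp]: "x \<in> carrier Q \<Longrightarrow> f x \<one>\<^bsub>Q\<^esub> = \<one>\<^bsub>E\<^esub>"
    and D_twist: "\<lbrakk>x \<in> carrier Q; y \<in> carrier Q; v \<in> carrier E\<rbrakk> \<Longrightarrow>
        D x (D y v) \<otimes>\<^bsub>E\<^esub> f x y = f x y \<otimes>\<^bsub>E\<^esub> D (x \<otimes>\<^bsub>Q\<^esub> y) v"
    and f_cocycle: "\<lbrakk>x \<in> carrier Q; y \<in> carrier Q; z \<in> carrier Q\<rbrakk> \<Longrightarrow>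
        D x (f y z) \<otimes>\<^bsub>E\<^esub> f x (y \<otimes>\<^bsub>Q\<^esub> z) = f x y \<otimes>\<^bsub>E\<^esub> f (x \<otimes>\<^bsub>Q\<^esub> y) z"
begin

abbreviation "P \<equiv> twisted_product E Q D f"

lemma D_closed [simp]: "x \<in> carrier Q \<Longrightarrow> v \<in> carrier E \<Longrightarrow> D x v \<in> carrier E"
  using D_hom by (auto simp: hom_def)

lemma D_mult: "\<lbrakk>x \<in> carrier Q; v \<in> carrier E; w \<in> carrier E\<rbrakk> \<Longrightarrow>
    D x (v \<otimes>\<^bsub>E\<^esub> w) = D x v \<otimes>\<^bsub>E\<^esub> D x w"
  using D_hom by (auto simp: hom_def)

lemma carrier_P [simp]: "carrier P = carrier E \<times> carrier Q"
  by (simp add: twisted_product_def)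

lemma one_P [simp]: "\<one>\<^bsub>P\<^esub> = (\<one>\<^bsub>E\<^esub>, \<one>\<^bsub>Q\<^esub>)"
  by (simp add: twisted_product_def)

lemma mult_P [simp]:
  "(v, x) \<otimes>\<^bsub>P\<^esub> (w, y) = (v \<otimes>\<^bsub>E\<^esub> D x w \<otimes>\<^bsub>E\<^esub> f x y, x \<otimes>\<^bsub>Q\<^esub> y)"
  by (simp add: twisted_product_def)

lemma mult_P_assoc:
  assumes "x \<in> carrier Q" "y \<in> carrier Q" "z \<in> carrier Q"
    and "u \<in> carrier E" "v \<in> carrier E" "w \<in> carrier E"
  shows "(u, x) \<otimes>\<^bsub>P\<^esub> (v, y) \<otimes>\<^bsub>P\<^esub> (w, z) = (u, x) \<otimes>\<^bsub>P\<^esub> ((v, y) \<otimes>\<^bsub>P\<^esub> (w, z))"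
proof -
  \<comment> \<open>The twist relation carries \<open>f x y\<close> across the
    \<open>D\<close>-image of \<open>w\<close>, after which the cocycle identity applies to the two
    remaining factors.\<close>
  have "f x y \<otimes>\<^bsub>E\<^esub> (D (x \<otimes>\<^bsub>Q\<^esub> y) w \<otimes>\<^bsub>E\<^esub> f (x \<otimes>\<^bsub>Q\<^esub> y) z)
      = D x (D y w) \<otimes>\<^bsub>E\<^esub> (f x y \<otimes>\<^bsub>E\<^esub> f (x \<otimes>\<^bsub>Q\<^esub> y) z)"
    using assms by (simp add: D_twist flip: E.m_assoc)
  also have "\<dots> = D x (D y w) \<otimes>\<^bsub>E\<^esub> (D x (f y z) \<otimes>\<^bsub>E\<^esub> f x (y \<otimes>\<^bsub>Q\<^esub> z))"
    using assms by (simp add: f_cocycle)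
  finally show ?thesis
    using assms by (simp add: D_mult E.m_assoc Q.m_assoc)
qed

text \<open>The first component is the solution of the equation for a left inverse, which is the
  form that \<open>groupI\<close> asks for.\<close>

definition inverse :: "'e \<times> 'q \<Rightarrow> 'e \<times> 'q" where
  "inverse = (\<lambda>(v, x). (inv\<^bsub>E\<^esub> (D (inv\<^bsub>Q\<^esub> x) v \<otimes>\<^bsub>E\<^esub> f (inv\<^bsub>Q\<^esub> x) x), inv\<^bsub>Q\<^esub> x))"

lemma inverse_closed: "a \<in> carrier P \<Longrightarrow> inverse a \<in> carrier P"
  by (auto simp: inverse_def)

lemma inverse_left: "a \<in> carrier P \<Longrightarrow> inverse a \<otimes>\<^bsub>P\<^esub> a = \<one>\<^bsub>P\<^esub>"
  by (auto simp: inverse_def E.m_assoc)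

lemma group_P: "group P"
proof (rule groupI)
  show "x \<otimes>\<^bsub>P\<^esub> y \<otimes>\<^bsub>P\<^esub> z = x \<otimes>\<^bsub>P\<^esub> (y \<otimes>\<^bsub>P\<^esub> z)"
    if "x \<in> carrier P" "y \<in> carrier P" "z \<in> carrier P" for x y z
    using that by (auto simp: mult_P_assoc simp del: mult_P)
  show "\<exists>y\<in>carrier P. y \<otimes>\<^bsub>P\<^esub> x = \<one>\<^bsub>P\<^esub>" if "x \<in> carrier P" for x
    using that inverse_closed inverse_left by blast
qed auto

lemma inv_P: "a \<in> carrier P \<Longrightarrow> inv\<^bsub>P\<^esub> a = inverse a"
  using group_P group.inv_equality inverse_closed inverse_left by metis

lemma inclusion_hom: "(\<lambda>v. (v, \<one>\<^bsub>Q\<^esub>)) \<in> hom E P"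
  by (simp add: hom_def)

lemma projection_hom: "snd \<in> hom P Q"
  by (auto simp: hom_def)

lemma kernel_projection: "kernel P Q snd = (\<lambda>v. (v, \<one>\<^bsub>Q\<^esub>)) ` carrier E"
  by (auto simp: kernel_def)

end

section \<open>Topology of the extension\<close>

lemma continuous_map_locally_eq:
  assumes "\<And>a. a \<in> topspace S \<Longrightarrow>
      \<exists>U g. openin S U \<and> a \<in> U \<and> continuous_map S T g \<and> (\<forall>b\<in>U. h b = g b)"
  shows "continuous_map S T h"
proof -
  obtain U g where U: "openin S (U a)" "a \<in> U a" "continuous_map S T (g a)"
      "\<forall>b\<in>U a. h b = g a b" if "a \<in> topspace S" for a
    using assms by metis
  show ?thesis
  proof (rule pasting_lemma [where I = "topspace S" and T = U and f = g])
    show "continuous_map (subtopology S (U i)) T (g i)" if "i \<in> topspace S" for i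
      using U that by (simp add: continuous_map_from_subtopology)
    show "g i x = g j x" if "i \<in> topspace S" "j \<in> topspace S" "x \<in> topspace S \<inter> U i \<inter> U j" for i j x
      using U(4)[OF that(1)] U(4)[OF that(2)] that(3) by fastforce
    show "\<exists>j. j \<in> topspace S \<and> x \<in> U j \<and> h x = g j x" if "x \<in> topspace S" for x
      using U that by blast
  qed (use U in auto)
qed

lemma continuous_map_group_mult:
  assumes "topological_group G T" "continuous_map S T g" "continuous_map S T h"
  shows "continuous_map S T (\<lambda>a. g a \<otimes>\<^bsub>G\<^esub> h a)"
proof -
  have "continuous_map S (prod_topology T T) (\<lambda>a. (g a, h a))"
    using assms by (simp add: continuous_map_pairedI)
  moreover have "continuous_map (prod_topology T T) T (\<lambda>(x, y). x \<otimes>\<^bsub>G\<^esub> y)"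
    using assms by (simp add: topological_group_def)
  ultimately show ?thesis
    by (auto dest: continuous_map_compose simp: o_def)
qed

text \<open>Since the twisting data are locally constant in the variables from \<open>Q\<close>,
  they can be frozen near each point. The \<open>E\<close>-components of multiplication and
  inversion then agree locally with maps built from the operations of \<open>E\<close> and a single
  \<open>D x\<close>, so the plain product topology is a group topology.\<close>

locale topological_factor_set = factor_set E Q D f
  for E :: "('e, 'f) monoid_scheme" and Q :: "('q, 'r) monoid_scheme"
    and D :: "'q \<Rightarrow> 'e \<Rightarrow> 'e" and f :: "'q \<Rightarrow> 'q \<Rightarrow> 'e" +
  fixes TE :: "'e topology" and TQ :: "'q topology"
  assumes top_E: "locally_compact_group E TE" and top_Q: "locally_compact_group Q TQ"
    and D_continuous: "x \<in> carrier Q \<Longrightarrow> continuous_map TE TE (D x)"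
    and D_locally_constant: "x \<in> carrier Q \<Longrightarrow>
        \<exists>U. openin TQ U \<and> x \<in> U \<and> (\<forall>x'\<in>U. \<forall>v\<in>carrier E. D x' v = D x v)"
    and f_locally_constant: "x \<in> carrier Q \<Longrightarrow> y \<in> carrier Q \<Longrightarrow>
        \<exists>U V. openin TQ U \<and> openin TQ V \<and> x \<in> U \<and> y \<in> V \<and> (\<forall>x'\<in>U. \<forall>y'\<in>V. f x' y' = f x y)"
begin

abbreviation "TP \<equiv> prod_topology TE TQ"

lemma topspace_E [simp]: "topspace TE = carrier E"
  and topspace_Q [simp]: "topspace TQ = carrier Q"
  using top_E top_Q by (auto simp: locally_compact_group_def topological_group_def)

lemma continuous_mult_E:
  "continuous_map S TE g \<Longrightarrow> continuous_map S TE h \<Longrightarrow> continuous_map S TE (\<lambda>a. g a \<otimes>\<^bsub>E\<^esub> h a)"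
  using top_E continuous_map_group_mult by (metis locally_compact_group_def)

lemma continuous_mult_Q:
  "continuous_map S TQ g \<Longrightarrow> continuous_map S TQ h \<Longrightarrow> continuous_map S TQ (\<lambda>a. g a \<otimes>\<^bsub>Q\<^esub> h a)"
  using top_Q continuous_map_group_mult by (metis locally_compact_group_def)

lemma continuous_inv:
  "continuous_map TE TE (\<lambda>a. inv\<^bsub>E\<^esub> a)" "continuous_map TQ TQ (\<lambda>a. inv\<^bsub>Q\<^esub> a)"
  using top_E top_Q by (auto simp: locally_compact_group_def topological_group_def)

lemma continuous_mult_P:
  "continuous_map (prod_topology TP TP) TP (\<lambda>(a, b). a \<otimes>\<^bsub>P\<^esub> b)"
proof -
  let ?X = "prod_topology TP TP"
  have c: "continuous_map ?X TE (\<lambda>a. fst (fst a))" "continuous_map ?X TQ (\<lambda>a. snd (fst a))"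
    "continuous_map ?X TE (\<lambda>a. fst (snd a))" "continuous_map ?X TQ (\<lambda>a. snd (snd a))"
    using continuous_map_compose[OF continuous_map_fst continuous_map_fst]
      continuous_map_compose[OF continuous_map_fst continuous_map_snd]
      continuous_map_compose[OF continuous_map_snd continuous_map_fst]
      continuous_map_compose[OF continuous_map_snd continuous_map_snd]
    by (auto simp: o_def)
  have "continuous_map ?X TE (\<lambda>a. fst (fst a) \<otimes>\<^bsub>E\<^esub> D (snd (fst a)) (fst (snd a))
          \<otimes>\<^bsub>E\<^esub> f (snd (fst a)) (snd (snd a)))"
  proof (rule continuous_map_locally_eq)
    fix a assume "a \<in> topspace ?X"
    then obtain v x w y where a: "a = ((v, x), (w, y))"
      and m: "v \<in> carrier E" "x \<in> carrier Q" "w \<in> carrier E" "y \<in> carrier Q"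
      by auto
    obtain U where U: "openin TQ U" "x \<in> U" "\<forall>x'\<in>U. \<forall>v\<in>carrier E. D x' v = D x v"
      using D_locally_constant m by blast
    obtain U' V where V: "openin TQ U'" "openin TQ V" "x \<in> U'" "y \<in> V"
        "\<forall>x'\<in>U'. \<forall>y'\<in>V. f x' y' = f x y"
      using f_locally_constant m by meson
    \<comment> \<open>On this open set the indices of \<open>D\<close> and \<open>f\<close> can be
      replaced by those of \<open>a\<close>.\<close>
    let ?N = "(carrier E \<times> (U \<inter> U')) \<times> (carrier E \<times> V)"
    have "openin ?X ?N"
      using U(1) V(1,2) openin_topspace[of TE] by (auto simp: openin_prod_Times_iff)
    moreover have "continuous_map ?X TE (\<lambda>a. fst (fst a) \<otimes>\<^bsub>E\<^esub> D x (fst (snd a)) \<otimes>\<^bsub>E\<^esub> f x y)"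
      using continuous_mult_E[OF continuous_mult_E[OF c(1)
          continuous_map_compose[OF c(3) D_continuous[OF m(2)], unfolded o_def]]] m
      by simp
    moreover have "\<forall>b\<in>?N. fst (fst b) \<otimes>\<^bsub>E\<^esub> D (snd (fst b)) (fst (snd b)) \<otimes>\<^bsub>E\<^esub> f (snd (fst b)) (snd (snd b))
       = fst (fst b) \<otimes>\<^bsub>E\<^esub> D x (fst (snd b)) \<otimes>\<^bsub>E\<^esub> f x y"
    proof
      fix b assume "b \<in> ?N"
      then obtain v' x' w' y' where b: "b = ((v', x'), (w', y'))"
          "w' \<in> carrier E" "x' \<in> U" "x' \<in> U'" "y' \<in> V"
        by blast
      have "D x' w' = D x w'" "f x' y' = f x y"
        using U(3) V(5) b by blast+
      then show "fst (fst b) \<otimes>\<^bsub>E\<^esub> D (snd (fst b)) (fst (snd b)) \<otimes>\<^bsub>E\<^esub> f (snd (fst b)) (snd (snd b))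
          = fst (fst b) \<otimes>\<^bsub>E\<^esub> D x (fst (snd b)) \<otimes>\<^bsub>E\<^esub> f x y"
        by (simp only: b fst_conv snd_conv)
    qed
    moreover have "a \<in> ?N" using a m U(2) V(3,4) by simp
    ultimately show "\<exists>N g. openin ?X N \<and> a \<in> N \<and> continuous_map ?X TE g \<and>
       (\<forall>b\<in>N. fst (fst b) \<otimes>\<^bsub>E\<^esub> D (snd (fst b)) (fst (snd b)) \<otimes>\<^bsub>E\<^esub> f (snd (fst b)) (snd (snd b)) = g b)"
      by blast
  qed
  then have "continuous_map ?X TP (\<lambda>a. (fst (fst a) \<otimes>\<^bsub>E\<^esub> D (snd (fst a)) (fst (snd a))
          \<otimes>\<^bsub>E\<^esub> f (snd (fst a)) (snd (snd a)), snd (fst a) \<otimes>\<^bsub>Q\<^esub> snd (snd a)))"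
    by (intro continuous_map_pairedI continuous_mult_Q c)
  moreover have "(\<lambda>(a, b). a \<otimes>\<^bsub>P\<^esub> b) = (\<lambda>a. (fst (fst a) \<otimes>\<^bsub>E\<^esub> D (snd (fst a)) (fst (snd a))
          \<otimes>\<^bsub>E\<^esub> f (snd (fst a)) (snd (snd a)), snd (fst a) \<otimes>\<^bsub>Q\<^esub> snd (snd a)))"
    by (auto simp: fun_eq_iff)
  ultimately show ?thesis by simp
qed

lemma continuous_inv_P: "continuous_map TP TP (\<lambda>a. inv\<^bsub>P\<^esub> a)"
proof -
  have c: "continuous_map TP TE fst" "continuous_map TP TQ snd"
      "continuous_map TP TQ (\<lambda>a. inv\<^bsub>Q\<^esub> (snd a))"
    using continuous_map_compose[OF continuous_map_snd continuous_inv(2)]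
    by (auto simp: continuous_map_fst continuous_map_snd o_def)
  have "continuous_map TP TE (\<lambda>a. D (inv\<^bsub>Q\<^esub> (snd a)) (fst a) \<otimes>\<^bsub>E\<^esub> f (inv\<^bsub>Q\<^esub> (snd a)) (snd a))"
  proof (rule continuous_map_locally_eq)
    fix a assume "a \<in> topspace TP"
    then obtain v x where a: "a = (v, x)" and m: "v \<in> carrier E" "x \<in> carrier Q" "inv\<^bsub>Q\<^esub> x \<in> carrier Q"
      by auto
    obtain U where U: "openin TQ U" "inv\<^bsub>Q\<^esub> x \<in> U"
        "\<forall>x'\<in>U. \<forall>v\<in>carrier E. D x' v = D (inv\<^bsub>Q\<^esub> x) v"
      using D_locally_constant m by blast
    obtain U' V where V: "openin TQ U'" "openin TQ V" "inv\<^bsub>Q\<^esub> x \<in> U'" "x \<in> V"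
        "\<forall>x'\<in>U'. \<forall>y'\<in>V. f x' y' = f (inv\<^bsub>Q\<^esub> x) x"
      using f_locally_constant m by meson
    \<comment> \<open>\<open>D\<close> and the first argument of \<open>f\<close> are evaluated at
      inverses, so their neighbourhoods are pulled back along inversion.\<close>
    let ?W = "{x' \<in> topspace TQ. inv\<^bsub>Q\<^esub> x' \<in> U \<inter> U'}"
    have "openin TQ ?W"
      by (rule openin_continuous_map_preimage[OF continuous_inv(2)]) (use U(1) V(1) in auto)
    then have "openin TP (carrier E \<times> (?W \<inter> V))"
      using V(2) openin_topspace[of TE] by (auto simp: openin_prod_Times_iff)
    moreover have "continuous_map TP TE (\<lambda>a. D (inv\<^bsub>Q\<^esub> x) (fst a) \<otimes>\<^bsub>E\<^esub> f (inv\<^bsub>Q\<^esub> x) x)"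
      using continuous_mult_E[OF continuous_map_compose[OF c(1) D_continuous[OF m(3)], unfolded o_def]] m
      by simp
    moreover have "\<forall>b\<in>carrier E \<times> (?W \<inter> V). D (inv\<^bsub>Q\<^esub> (snd b)) (fst b) \<otimes>\<^bsub>E\<^esub> f (inv\<^bsub>Q\<^esub> (snd b)) (snd b)
       = D (inv\<^bsub>Q\<^esub> x) (fst b) \<otimes>\<^bsub>E\<^esub> f (inv\<^bsub>Q\<^esub> x) x"
      proof
      fix b assume "b \<in> carrier E \<times> (?W \<inter> V)"
      then obtain w y where b: "b = (w, y)" "w \<in> carrier E" "inv\<^bsub>Q\<^esub> y \<in> U" "inv\<^bsub>Q\<^esub> y \<in> U'" "y \<in> V"
        by blast
      have "D (inv\<^bsub>Q\<^esub> y) w = D (inv\<^bsub>Q\<^esub> x) w" "f (inv\<^bsub>Q\<^esub> y) y = f (inv\<^bsub>Q\<^esub> x) x"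
        using U(3) V(5) b by blast+
      then show "D (inv\<^bsub>Q\<^esub> (snd b)) (fst b) \<otimes>\<^bsub>E\<^esub> f (inv\<^bsub>Q\<^esub> (snd b)) (snd b)
          = D (inv\<^bsub>Q\<^esub> x) (fst b) \<otimes>\<^bsub>E\<^esub> f (inv\<^bsub>Q\<^esub> x) x"
        by (simp only: b fst_conv snd_conv)
    qed
    moreover have "a \<in> carrier E \<times> (?W \<inter> V)" using a m U(2) V(3,4) by simp
    ultimately show "\<exists>N g. openin TP N \<and> a \<in> N \<and> continuous_map TP TE g \<and>
       (\<forall>b\<in>N. D (inv\<^bsub>Q\<^esub> (snd b)) (fst b) \<otimes>\<^bsub>E\<^esub> f (inv\<^bsub>Q\<^esub> (snd b)) (snd b) = g b)"
      by blast
  qed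
  then have "continuous_map TP TE
      (\<lambda>a. inv\<^bsub>E\<^esub> (D (inv\<^bsub>Q\<^esub> (snd a)) (fst a) \<otimes>\<^bsub>E\<^esub> f (inv\<^bsub>Q\<^esub> (snd a)) (snd a)))"
    by (rule continuous_map_compose[OF _ continuous_inv(1), unfolded o_def])
  then have "continuous_map TP TP
      (\<lambda>a. (inv\<^bsub>E\<^esub> (D (inv\<^bsub>Q\<^esub> (snd a)) (fst a) \<otimes>\<^bsub>E\<^esub> f (inv\<^bsub>Q\<^esub> (snd a)) (snd a)),
        inv\<^bsub>Q\<^esub> (snd a)))"
    using c(3) by (rule continuous_map_pairedI)
  then show ?thesis
    by (rule continuous_map_eq) (auto simp: inv_P inverse_def)
qed

lemma locally_compact_group_P: "locally_compact_group P TP"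
  using top_E top_Q group_P continuous_mult_P continuous_inv_P
  by (simp add: locally_compact_group_def topological_group_def Hausdorff_space_prod_topology
      locally_compact_space_prod_topology)

text \<open>The inclusion is the graph of a constant map.\<close>

lemma embedding_inclusion: "embedding_map TE TP (\<lambda>v. (v, \<one>\<^bsub>Q\<^esub>))"
  by (simp add: embedding_map_graph)

lemma quotient_projection: "quotient_map TP TQ snd"
  \<comment> \<open>The projection is onto because \<open>E\<close> contains its identity.\<close>
  using E.one_closed by (auto simp flip: topspace_E)

end

section \<open>Cosets and finite index\<close>

lemma (in group) inv_cancel_left:
  assumes "x \<in> carrier G" "y \<in> carrier G"
  shows "inv x \<otimes> (x \<otimes> y) = y" "x \<otimes> (inv x \<otimes> y) = y"
  using assms by (simp_all flip: m_assoc)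

lemma (in group) l_coset_eq_iff:
  assumes "subgroup H G" "x \<in> carrier G" "y \<in> carrier G"
  shows "x <# H = y <# H \<longleftrightarrow> inv x \<otimes> y \<in> H"
proof
  assume "x <# H = y <# H"
  then have "y \<in> x <# H"
    using assms lcos_self by metis
  then show "inv x \<otimes> y \<in> H"
    using assms subgroup.lcos_module_imp group_axioms by metis
next
  assume h: "inv x \<otimes> y \<in> H"
  have "y = x \<otimes> (inv x \<otimes> y)"
    using assms by (simp flip: m_assoc)
  then have "y \<in> x <# H"
    using h unfolding l_coset_def by blast
  then show "x <# H = y <# H"
    using assms l_repr_independence by metis
qed

lemma (in group) l_coset_self_iff:
  assumes "subgroup H G" "x \<in> carrier G"
  shows "x <# H = H \<longleftrightarrow> x \<in> H"
proof -
  have "x <# H = H \<longleftrightarrow> \<one> <# H = x <# H"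
    using assms subgroup.subset lcos_mult_one by metis
  then show ?thesis
    using l_coset_eq_iff[of H \<one> x] assms by simp
qed

text \<open>A left coset of the intersection is the intersection of the two left cosets with the
  same representative, so there are at most as many as pairs of cosets.\<close>

lemma (in group) finite_index_subgroup_Int:
  assumes "finite_index_subgroup G H K" "finite_index_subgroup G H' K" "K \<subseteq> carrier G"
  shows "finite_index_subgroup G (H \<inter> H') K"
proof -
  have sub: "subgroup H G" "subgroup H' G" "H \<subseteq> K"
    and fin: "finite ({k <# H |k. k \<in> K} \<times> {k <# H' |k. k \<in> K})"
    using assms by (auto simp: finite_index_subgroup_def)
  have sub': "subgroup (H \<inter> H') G"
    using sub subgroups_Inter_pair by blast
  have "k <# (H \<inter> H') = (k <# H) \<inter> (k <# H')" if "k \<in> K" for k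
  proof
    show "(k <# H) \<inter> (k <# H') \<subseteq> k <# (H \<inter> H')"
    proof
      fix a assume "a \<in> (k <# H) \<inter> (k <# H')"
      then obtain h h' where "h \<in> H" "h' \<in> H'" "a = k \<otimes> h" "a = k \<otimes> h'"
        unfolding l_coset_def by blast
      moreover from this have "h = h'"
        using l_cancel[of k h h'] that assms(3) subgroup.mem_carrier[OF sub(1)] subgroup.mem_carrier[OF sub(2)]
        by auto
      ultimately show "a \<in> k <# (H \<inter> H')"
        unfolding l_coset_def by blast
    qed
  qed (auto simp: l_coset_def)
  then have "{k <# (H \<inter> H') |k. k \<in> K} \<subseteq>
      (\<lambda>(a, b). a \<inter> b) ` ({k <# H |k. k \<in> K} \<times> {k <# H' |k. k \<in> K})"
    by auto
  then show ?thesis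
    using fin sub sub' unfolding finite_index_subgroup_def
    by (meson finite_imageI finite_subset le_infI1)
qed

lemma (in group) finite_index_subgroup_refl:
  assumes "subgroup K G"
  shows "finite_index_subgroup G K K"
proof -
  have "{k <# K |k. k \<in> K} \<subseteq> {K}"
    using l_coset_self_iff[OF assms] subgroup.mem_carrier[OF assms] by auto
  then show ?thesis
    using assms finite_subset by (auto simp: finite_index_subgroup_def)
qed

lemma (in group) finite_index_subgroup_INT:
  assumes "finite S" "subgroup K G" "\<And>s. s \<in> S \<Longrightarrow> finite_index_subgroup G (H s) K"
  shows "finite_index_subgroup G (K \<inter> (\<Inter>s\<in>S. H s)) K"
  using assms(1,3)
proof (induction S)
  case empty
  then show ?case using finite_index_subgroup_refl[OF assms(2)] by simp
next
  case (insert s S)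
  then have "finite_index_subgroup G ((K \<inter> (\<Inter>s\<in>S. H s)) \<inter> H s) K"
    using subgroup.subset[OF assms(2)]
    by (intro finite_index_subgroup_Int[OF insert.IH]) simp_all
  moreover have "(K \<inter> (\<Inter>s\<in>S. H s)) \<inter> H s = K \<inter> (\<Inter>s\<in>insert s S. H s)" by blast
  ultimately show ?case by simp
qed

lemma (in group) finite_index_representatives:
  assumes "finite_index_subgroup G H K" "K \<subseteq> carrier G"
  shows "\<exists>R. finite R \<and> R \<subseteq> K \<and> (\<forall>k\<in>K. \<exists>r\<in>R. k <# H = r <# H)"
proof -
  have "{k <# H |k. k \<in> K} = (\<lambda>k. k <# H) ` K" by blast
  then have "finite ((\<lambda>k. k <# H) ` K)"
    using assms(1) by (simp add: finite_index_subgroup_def)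
  then obtain R where "finite R" "R \<subseteq> K" "(\<lambda>k. k <# H) ` K = (\<lambda>k. k <# H) ` R"
    using finite_subset_image[of "(\<lambda>k. k <# H) ` K" "\<lambda>k. k <# H" K] by blast
  then show ?thesis
    by (metis (no_types, lifting) imageE imageI)
qed

text \<open>Write \<open>l = r (g k inv g)\<close> with \<open>r\<close> from representatives of
  \<open>L\<close> modulo \<open>conj_set G g L \<inter> L\<close> and \<open>k \<in> L\<close>.
  Then \<open>l g = r g k\<close>, and \<open>k\<close> matters only modulo \<open>H\<close>. This
  finiteness later makes a point stabiliser in the completion compact.\<close>

lemma hecke_pair_finite_orbit:
  fixes G (structure)
  assumes "hecke_pair G L" and "finite_index_subgroup G H L" and g: "g \<in> carrier G"
  shows "finite {l <# (g <# H) |l. l \<in> L}"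
proof -
  interpret group G using assms by (simp add: hecke_pair_def)
  have L: "subgroup L G" and H: "subgroup H G" "H \<subseteq> L"
    using assms by (auto simp: hecke_pair_def finite_index_subgroup_def)
  note [simp] = subgroup.mem_carrier[OF L] subgroup.mem_carrier[OF H(1)]
  have Lc: "L \<subseteq> carrier G" using L subgroup.subset by blast
  let ?M = "conj_set G g L \<inter> L"
  have M: "finite_index_subgroup G ?M L"
    using assms by (simp add: hecke_pair_def)
  obtain R where R: "finite R" "R \<subseteq> L" "\<forall>k\<in>L. \<exists>r\<in>R. k <# ?M = r <# ?M"
    using finite_index_representatives[OF M Lc] by meson
  obtain R' where R': "finite R'" "R' \<subseteq> L" "\<forall>k\<in>L. \<exists>r\<in>R'. k <# H = r <# H"
    using finite_index_representatives[OF assms(2) Lc] by meson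
  have "{l <# (g <# H) |l. l \<in> L} \<subseteq> (\<lambda>(r, s). (r \<otimes> g \<otimes> s) <# H) ` (R \<times> R')"
  proof
    fix C assume "C \<in> {l <# (g <# H) |l. l \<in> L}"
    then obtain l where l: "l \<in> L" "C = l <# (g <# H)" by blast
    obtain r where r: "r \<in> R" "l <# ?M = r <# ?M" using R l by blast
    have rc: "r \<in> carrier G" using r R Lc by blast
    have "inv r \<otimes> l \<in> ?M"
      using l_coset_eq_iff[of ?M r l] M r l rc by (simp add: finite_index_subgroup_def)
    then obtain k where k: "k \<in> L" "inv r \<otimes> l = g \<otimes> k \<otimes> inv g"
      by (auto simp: conj_set_def)
    obtain s where s: "s \<in> R'" "k <# H = s <# H" using R' k by blast
    have sc: "s \<in> carrier G" using s R' Lc by blast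
    have "l = r \<otimes> (g \<otimes> k \<otimes> inv g)"
      using k l rc by (metis inv_solve_left' Lc subsetD inv_closed m_closed g)
    then have "l \<otimes> g = r \<otimes> g \<otimes> k"
      using g k rc by (simp add: m_assoc)
    then have "C = (r \<otimes> g \<otimes> k) <# H"
      using l g H by (simp add: lcos_m_assoc subgroup.subset)
    also have "\<dots> = (r \<otimes> g \<otimes> s) <# H"
      using s sc rc k g H lcos_m_assoc[of H "r \<otimes> g"] by (metis Lc m_closed subgroup.subset subsetD)
    finally show "C \<in> (\<lambda>(r, s). (r \<otimes> g \<otimes> s) <# H) ` (R \<times> R')"
      using r s by auto
  qed
  then show ?thesis
    by (rule finite_subset) (simp add: R(1) R'(1))
qed

section \<open>Coset spaces\<close>

text \<open>The predicate has to be shown to be a topology before \<open>openin\<close> can be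
  unfolded.\<close>

lemma openin_coset_space_topology:
  assumes "topological_group G T" "subgroup H G"
  shows "openin (coset_space_topology G T H) U \<longleftrightarrow> U \<subseteq> lcosets\<^bsub>G\<^esub> H \<and> openin T (\<Union>U)"
proof -
  interpret group G using assms by (simp add: topological_group_def)
  have "istopology (\<lambda>U. U \<subseteq> lcosets\<^bsub>G\<^esub> H \<and> openin T (\<Union>U))"
    unfolding istopology_def
  proof (rule conjI; intro allI impI)
    fix U V
    assume a: "U \<subseteq> lcosets\<^bsub>G\<^esub> H \<and> openin T (\<Union>U)" "V \<subseteq> lcosets\<^bsub>G\<^esub> H \<and> openin T (\<Union>V)"
    \<comment> \<open>Distinct cosets are disjoint, so unions commute with the intersection of two
      families of cosets.\<close>
    have "\<Union>(U \<inter> V) = \<Union>U \<inter> \<Union>V"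
      using a lcos_disjoint[OF assms(2)] by blast
    then show "U \<inter> V \<subseteq> lcosets\<^bsub>G\<^esub> H \<and> openin T (\<Union>(U \<inter> V))"
      using a by auto
  next
    fix \<K> assume a: "\<forall>K\<in>\<K>. K \<subseteq> lcosets\<^bsub>G\<^esub> H \<and> openin T (\<Union>K)"
    have "\<Union>(\<Union>\<K>) = \<Union>(Union ` \<K>)" by blast
    then show "\<Union>\<K> \<subseteq> lcosets\<^bsub>G\<^esub> H \<and> openin T (\<Union>(\<Union>\<K>))" using a by auto
  qed
  then show ?thesis
    by (simp add: coset_space_topology_def)
qed

lemma topspace_coset_space_topology:
  assumes "topological_group G T" "subgroup H G"
  shows "topspace (coset_space_topology G T H) = lcosets\<^bsub>G\<^esub> H"
proof -
  have "openin T (\<Union>(lcosets\<^bsub>G\<^esub> H))"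
    using assms by (metis group.lcosets_part_G openin_topspace topological_group_def)
  then have "openin (coset_space_topology G T H) (lcosets\<^bsub>G\<^esub> H)"
    using openin_coset_space_topology[OF assms] by blast
  moreover have "topspace (coset_space_topology G T H) \<subseteq> lcosets\<^bsub>G\<^esub> H"
    using openin_coset_space_topology[OF assms] openin_topspace by blast
  ultimately show ?thesis
    using openin_subset by blast
qed

text \<open>The covering hypothesis makes every left coset meet \<open>M\<close>, so the coset space
  is the image of a compact set under the quotient map.\<close>

lemma compact_coset_spaceI:
  assumes G: "topological_group G T" and H: "subgroup H G" and M: "compactin T M"
    and cover: "\<And>x. x \<in> carrier G \<Longrightarrow> \<exists>h\<in>H. x \<otimes>\<^bsub>G\<^esub> h \<in> M"
  shows "compact_space (coset_space_topology G T H)"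
proof -
  interpret group G using G by (simp add: topological_group_def)
  have T: "topspace T = carrier G" using G by (simp add: topological_group_def)
  have "continuous_map T (coset_space_topology G T H) (\<lambda>x. x <#\<^bsub>G\<^esub> H)"
    unfolding continuous_map_def topspace_coset_space_topology[OF G H]
  proof (intro conjI allI impI)
    show "(\<lambda>x. x <#\<^bsub>G\<^esub> H) \<in> topspace T \<rightarrow> lcosets\<^bsub>G\<^esub> H"
      using T by (auto simp: LCOSETS_def)
    fix U assume "openin (coset_space_topology G T H) U"
    then have U: "U \<subseteq> lcosets\<^bsub>G\<^esub> H" "openin T (\<Union>U)"
      using openin_coset_space_topology[OF G H] by auto
    have "{x \<in> topspace T. x <#\<^bsub>G\<^esub> H \<in> U} = \<Union>U"
    proof
      show "{x \<in> topspace T. x <#\<^bsub>G\<^esub> H \<in> U} \<subseteq> \<Union>U"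
        using T lcos_self[OF _ H] by auto
      show "\<Union>U \<subseteq> {x \<in> topspace T. x <#\<^bsub>G\<^esub> H \<in> U}"
      proof
        fix x assume "x \<in> \<Union>U"
        then obtain C where C: "C \<in> U" "x \<in> C" by blast
        then obtain a where a: "a \<in> carrier G" "C = a <#\<^bsub>G\<^esub> H"
          using U by (auto simp: LCOSETS_def)
        have "C = x <#\<^bsub>G\<^esub> H"
          using C a l_repr_independence[OF _ _ H] by blast
        then show "x \<in> {x \<in> topspace T. x <#\<^bsub>G\<^esub> H \<in> U}"
          using C U openin_subset by blast
      qed
    qed
    then show "openin T {x \<in> topspace T. x <#\<^bsub>G\<^esub> H \<in> U}" using U by simp
  qed
  then have "compactin (coset_space_topology G T H) ((\<lambda>x. x <#\<^bsub>G\<^esub> H) ` M)"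
    using M image_compactin by blast
  moreover have "lcosets\<^bsub>G\<^esub> H \<subseteq> (\<lambda>x. x <#\<^bsub>G\<^esub> H) ` M"
  proof
    fix C assume "C \<in> lcosets\<^bsub>G\<^esub> H"
    then obtain x where x: "x \<in> carrier G" "C = x <#\<^bsub>G\<^esub> H" by (auto simp: LCOSETS_def)
    then obtain h where h: "h \<in> H" "x \<otimes>\<^bsub>G\<^esub> h \<in> M" using cover by blast
    then have "x \<otimes>\<^bsub>G\<^esub> h \<in> x <#\<^bsub>G\<^esub> H" by (auto simp: l_coset_def)
    then have "C = (x \<otimes>\<^bsub>G\<^esub> h) <#\<^bsub>G\<^esub> H"
      using x l_repr_independence[OF _ _ H] by blast
    then show "C \<in> (\<lambda>x. x <#\<^bsub>G\<^esub> H) ` M" using h by blast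
  qed
  ultimately show ?thesis
    using topspace_coset_space_topology[OF G H] compactin_subset_topspace
    by (metis compact_space_def subset_antisym)
qed

lemma continuous_right_translation:
  assumes "topological_group G T" "h \<in> carrier G"
  shows "continuous_map T T (\<lambda>x. x \<otimes>\<^bsub>G\<^esub> h)"
  using assms by (intro continuous_map_group_mult) (auto simp: topological_group_def)

text \<open>Local compactness covers \<open>G\<close> by open sets \<open>U x\<close> inside compact
  sets \<open>K x\<close>. Finitely many images of the \<open>U x\<close> cover the coset space, and
  the union of the corresponding \<open>K x\<close> serves as \<open>M\<close>.\<close>

lemma compact_coset_spaceE:
  assumes G: "locally_compact_group G T" and H: "subgroup H G"
    and comp: "compact_space (coset_space_topology G T H)"
  obtains M where "compactin T M" "\<And>x. x \<in> carrier G \<Longrightarrow> \<exists>h\<in>H. x \<otimes>\<^bsub>G\<^esub> h \<in> M"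
proof -
  have tg: "topological_group G T" using G by (simp add: locally_compact_group_def)
  interpret group G using tg by (simp add: topological_group_def)
  have T: "topspace T = carrier G" using tg by (simp add: topological_group_def)
  note Hc = subgroup.mem_carrier[OF H]
  obtain U K where UK: "openin T (U x)" "compactin T (K x)" "x \<in> U x" "U x \<subseteq> K x"
    if "x \<in> carrier G" for x
    using G T unfolding locally_compact_group_def locally_compact_space_def by metis
  define V where "V x = (\<lambda>u. u <#\<^bsub>G\<^esub> H) ` U x" for x
  have Uc: "U x \<subseteq> carrier G" if "x \<in> carrier G" for x
    using UK(1)[OF that] openin_subset T by blast
  have Vopen: "openin (coset_space_topology G T H) (V x)" if x: "x \<in> carrier G" for x
  proof -
    \<comment> \<open>The saturation of \<open>U x\<close> is a union of preimages of
      \<open>U x\<close> under right translations, which is why its image in the coset space is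
      open.\<close>
    have "\<Union>(V x) = (\<Union>h\<in>H. {y \<in> topspace T. y \<otimes>\<^bsub>G\<^esub> inv\<^bsub>G\<^esub> h \<in> U x})" (is "?L = ?R")
    proof
      show "?L \<subseteq> ?R"
      proof
        fix y assume "y \<in> ?L"
        then obtain u h where u: "u \<in> U x" "h \<in> H" "y = u \<otimes>\<^bsub>G\<^esub> h"
          by (auto simp: V_def l_coset_def)
        moreover have "u \<in> carrier G" "h \<in> carrier G"
          using u Uc[OF x] Hc by auto
        ultimately have "y \<in> topspace T" "y \<otimes>\<^bsub>G\<^esub> inv\<^bsub>G\<^esub> h \<in> U x"
          using T by (simp_all add: m_assoc)
        then show "y \<in> ?R"
          using u by blast
      qed
      show "?R \<subseteq> ?L"
      proof
        fix y assume "y \<in> ?R"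
        then obtain h where h: "h \<in> H" "y \<in> carrier G" "y \<otimes>\<^bsub>G\<^esub> inv\<^bsub>G\<^esub> h \<in> U x"
          using T by blast
        then have "y = (y \<otimes>\<^bsub>G\<^esub> inv\<^bsub>G\<^esub> h) \<otimes>\<^bsub>G\<^esub> h"
          using Hc by (simp add: m_assoc)
        then show "y \<in> ?L"
          using h by (auto simp: V_def l_coset_def)
      qed
    qed
    moreover have "openin T {y \<in> topspace T. y \<otimes>\<^bsub>G\<^esub> inv\<^bsub>G\<^esub> h \<in> U x}" if "h \<in> H" for h
      using openin_continuous_map_preimage[OF continuous_right_translation[OF tg] UK(1)[OF x]] Hc that
      by simp
    ultimately have "openin T (\<Union>(V x))"
      by auto
    moreover have "V x \<subseteq> lcosets\<^bsub>G\<^esub> H"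
      using Uc[OF x] by (auto simp: V_def LCOSETS_def)
    ultimately show ?thesis
      using openin_coset_space_topology[OF tg H] by blast
  qed
  have "\<exists>F. finite F \<and> F \<subseteq> V ` carrier G \<and> topspace (coset_space_topology G T H) \<subseteq> \<Union>F"
    using comp unfolding compact_space_def compactin_def
  proof (elim conjE allE[of _ "V ` carrier G"] impE)
    show "Ball (V ` carrier G) (openin (coset_space_topology G T H)) \<and>
        topspace (coset_space_topology G T H) \<subseteq> \<Union>(V ` carrier G)"
      unfolding topspace_coset_space_topology[OF tg H]
      using Vopen UK(3) by (auto simp: LCOSETS_def V_def)
  qed
  then obtain F where F: "finite F" "F \<subseteq> carrier G" "lcosets\<^bsub>G\<^esub> H \<subseteq> \<Union>(V ` F)"
    unfolding topspace_coset_space_topology[OF tg H] using finite_subset_image by metis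
  show thesis
  proof
    show "compactin T (\<Union>(K ` F))"
      using F UK(2) by (intro compactin_Union) auto
    fix x assume x: "x \<in> carrier G"
    then have "x <#\<^bsub>G\<^esub> H \<in> lcosets\<^bsub>G\<^esub> H" by (auto simp: LCOSETS_def)
    then obtain y u where y: "y \<in> F" "u \<in> U y" "x <#\<^bsub>G\<^esub> H = u <#\<^bsub>G\<^esub> H"
      using F by (auto simp: V_def)
    then have u: "u \<in> carrier G" using Uc F by blast
    then have "inv\<^bsub>G\<^esub> x \<otimes>\<^bsub>G\<^esub> u \<in> H"
      using l_coset_eq_iff[OF H x] y by blast
    moreover have "x \<otimes>\<^bsub>G\<^esub> (inv\<^bsub>G\<^esub> x \<otimes>\<^bsub>G\<^esub> u) = u"
      using x u by (simp flip: m_assoc)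
    moreover have "u \<in> \<Union>(K ` F)"
      using y UK(4) F by blast
    ultimately show "\<exists>h\<in>H. x \<otimes>\<^bsub>G\<^esub> h \<in> \<Union>(K ` F)" by metis
  qed
qed

text \<open>The finitely many other points of \<open>H\<close> in \<open>U\<close> form a closed
  set, which can be removed from \<open>U\<close>. Discreteness thus follows from neighbourhoods
  meeting \<open>H\<close> in finite sets.\<close>

lemma openin_singleton_if_finite_nbhd:
  assumes "Hausdorff_space T" "H \<subseteq> topspace T" "x \<in> H" "openin T U" "x \<in> U" "finite (U \<inter> H)"
  shows "openin (subtopology T H) {x}"
proof -
  have "closedin T (U \<inter> H - {x})"
    using assms by (intro closedin_Hausdorff_finite) auto
  then have "openin T (U - (U \<inter> H - {x}))"
    using assms(4) by (rule openin_diff[rotated])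
  moreover have "{x} = (U - (U \<inter> H - {x})) \<inter> H"
    using assms by blast
  ultimately show ?thesis
    by (auto simp: openin_subtopology)
qed

section \<open>Schlichting completions\<close>

text \<open>Finiteness of the \<open>L\<close>-orbits on the coset space is what the Hecke condition
  supplies. It is stated for \<open>L\<close> itself so that \<open>L\<close> may be a finite index
  subgroup of the given one.\<close>

locale finite_orbit_subgroup = group G for G :: "('g, 'b) monoid_scheme" (structure) +
  fixes L :: "'g set"
  assumes L_subgroup: "subgroup L G"
    and finite_orbit: "g \<in> carrier G \<Longrightarrow> finite {l <# (g <# L) |l. l \<in> L}"
begin

abbreviation "\<Omega> \<equiv> lcosets L"
abbreviation "S \<equiv> schlichting_group G L"
abbreviation "TS \<equiv> schlichting_topology G L"
abbreviation "lam \<equiv> schlichting_map G L"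

lemma L_carrier: "L \<subseteq> carrier G"
  using L_subgroup subgroup.subset by blast

lemma coset_in [simp]: "g \<in> carrier G \<Longrightarrow> g <# L \<in> \<Omega>"
  by (auto simp: LCOSETS_def)

lemma L_in [simp]: "L \<in> \<Omega>"
  using coset_in[of \<one>] L_carrier by (simp add: lcos_mult_one)

lemma coset_obtain:
  assumes "C \<in> \<Omega>" obtains g where "g \<in> carrier G" "C = g <# L"
  using assms by (auto simp: LCOSETS_def)

lemma coset_subset: "C \<in> \<Omega> \<Longrightarrow> C \<subseteq> carrier G"
  using lcosets_subset_PowG[OF L_subgroup] by blast

lemma act_in [simp]: "g \<in> carrier G \<Longrightarrow> C \<in> \<Omega> \<Longrightarrow> g <# C \<in> \<Omega>"
  by (metis coset_in coset_obtain lcos_m_assoc L_carrier m_closed)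

lemma act_act: "g \<in> carrier G \<Longrightarrow> h \<in> carrier G \<Longrightarrow> C \<in> \<Omega> \<Longrightarrow> g <# (h <# C) = (g \<otimes> h) <# C"
  using lcos_m_assoc coset_subset by simp

lemma act_one [simp]: "C \<in> \<Omega> \<Longrightarrow> \<one> <# C = C"
  using lcos_mult_one coset_subset by simp

lemma act_inv [simp]: "g \<in> carrier G \<Longrightarrow> C \<in> \<Omega> \<Longrightarrow> inv g <# (g <# C) = C"
    "g \<in> carrier G \<Longrightarrow> C \<in> \<Omega> \<Longrightarrow> g <# (inv g <# C) = C"
  by (simp_all add: act_act)

lemma act_inj: "g \<in> carrier G \<Longrightarrow> C \<in> \<Omega> \<Longrightarrow> C' \<in> \<Omega> \<Longrightarrow> g <# C = g <# C' \<longleftrightarrow> C = C'"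
  by (metis act_inv(1))

lemma lam_apply [simp]: "C \<in> \<Omega> \<Longrightarrow> lam g C = g <# C"
  by (simp add: schlichting_map_def)

lemma lam_sym: "g \<in> carrier G \<Longrightarrow> lam g \<in> sym_cosets G L"
  unfolding sym_cosets_def
proof (intro CollectI conjI)
  assume g: "g \<in> carrier G"
  show "lam g \<in> \<Omega> \<rightarrow>\<^sub>E \<Omega>"
    using g by (auto simp: schlichting_map_def)
  show "bij_betw (lam g) \<Omega> \<Omega>"
    using g by (intro bij_betw_byWitness[where f' = "lam (inv g)"]) auto
qed

lemma sym_bij: "x \<in> sym_cosets G L \<Longrightarrow> bij_betw x \<Omega> \<Omega>"
  and sym_ext: "x \<in> sym_cosets G L \<Longrightarrow> x \<in> extensional \<Omega>"
  by (auto simp: sym_cosets_def PiE_def)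

lemma sym_in: "x \<in> sym_cosets G L \<Longrightarrow> C \<in> \<Omega> \<Longrightarrow> x C \<in> \<Omega>"
  by (auto simp: sym_cosets_def)

section \<open>Pointwise convergence and finite approximation\<close>

abbreviation "TX \<equiv> product_topology (\<lambda>_. discrete_topology \<Omega>) \<Omega>"

lemma topspace_TX: "topspace TX = \<Omega> \<rightarrow>\<^sub>E \<Omega>"
  by simp

lemma openin_TX_agree:
  assumes "finite F" "F \<subseteq> \<Omega>"
  shows "openin TX {y \<in> topspace TX. \<forall>C\<in>F. y C = x C}"
proof -
  have "openin TX {y \<in> topspace TX. y C \<in> {x C} \<inter> \<Omega>}" if "C \<in> \<Omega>" for C
    by (rule openin_continuous_map_preimage[OF continuous_map_product_projection[OF that]]) simp
  then have "openin TX ((\<Inter>C\<in>F. {y \<in> topspace TX. y C \<in> {x C} \<inter> \<Omega>}) \<inter> topspace TX)"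
    using assms by (intro openin_INT) auto
  moreover have "(\<Inter>C\<in>F. {y \<in> topspace TX. y C \<in> {x C} \<inter> \<Omega>}) \<inter> topspace TX
      = {y \<in> topspace TX. \<forall>C\<in>F. y C = x C}"
  proof -
    have "y C \<in> \<Omega>" if "y \<in> topspace TX" "C \<in> F" for y C
      using that assms(2) unfolding topspace_TX by (meson PiE_mem subsetD)
    then show ?thesis by blast
  qed
  ultimately show ?thesis by (simp only:)
qed

text \<open>Only the finitely many coordinates in which a basic box is a proper subset of
  \<open>\<Omega>\<close> restrict a function, and taking the values of \<open>x\<close> there keeps
  it in the box.\<close>

lemma nbhd_TX:
  assumes "openin TX U" "x \<in> U"
  shows "\<exists>F. finite F \<and> F \<subseteq> \<Omega> \<and> {y \<in> topspace TX. \<forall>C\<in>F. y C = x C} \<subseteq> U"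
proof -
  obtain V where V: "finite {C \<in> \<Omega>. V C \<noteq> \<Omega>}" "x \<in> Pi\<^sub>E \<Omega> V" "Pi\<^sub>E \<Omega> V \<subseteq> U"
    using assms by (auto simp: openin_product_topology_alt)
  have "{y \<in> topspace TX. \<forall>C\<in>{C \<in> \<Omega>. V C \<noteq> \<Omega>}. y C = x C} \<subseteq> Pi\<^sub>E \<Omega> V"
  proof
    fix y assume y: "y \<in> {y \<in> topspace TX. \<forall>C\<in>{C \<in> \<Omega>. V C \<noteq> \<Omega>}. y C = x C}"
    show "y \<in> Pi\<^sub>E \<Omega> V"
    proof (rule PiE_I)
      fix C assume C: "C \<in> \<Omega>"
      show "y C \<in> V C"
        using y C V(2) by (cases "V C = \<Omega>") (auto simp: PiE_iff)
    qed (use y in \<open>auto simp: PiE_iff extensional_def\<close>)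
  qed
  then have "finite {C \<in> \<Omega>. V C \<noteq> \<Omega>} \<and> {C \<in> \<Omega>. V C \<noteq> \<Omega>} \<subseteq> \<Omega> \<and>
      {y \<in> topspace TX. \<forall>C\<in>{C \<in> \<Omega>. V C \<noteq> \<Omega>}. y C = x C} \<subseteq> U"
    using V(1,3) by (intro conjI) (assumption | rule Collect_subset | rule subset_trans)+
  then show ?thesis by (rule exI)
qed

lemma closure_TX:
  assumes "A \<subseteq> topspace TX"
  shows "x \<in> TX closure_of A \<longleftrightarrow>
    x \<in> topspace TX \<and> (\<forall>F. finite F \<longrightarrow> F \<subseteq> \<Omega> \<longrightarrow> (\<exists>y\<in>A. \<forall>C\<in>F. y C = x C))"
    (is "?l \<longleftrightarrow> ?r")
proof
  assume l: ?l
  then have x: "x \<in> topspace TX" by (meson in_closure_of)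
  moreover have "\<exists>y\<in>A. \<forall>C\<in>F. y C = x C" if "finite F" "F \<subseteq> \<Omega>" for F
  proof -
    have "x \<in> {y \<in> topspace TX. \<forall>C\<in>F. y C = x C} \<and> openin TX {y \<in> topspace TX. \<forall>C\<in>F. y C = x C}"
      using x openin_TX_agree[OF that, of x] by simp
    then obtain y where "y \<in> A" "y \<in> {y \<in> topspace TX. \<forall>C\<in>F. y C = x C}"
      using l[unfolded in_closure_of] by meson
    then show ?thesis by blast
  qed
  ultimately show ?r by blast
next
  assume r: ?r
  show ?l
    unfolding in_closure_of
  proof (intro conjI allI impI)
    show "x \<in> topspace TX" using r by blast
    fix U assume "x \<in> U \<and> openin TX U"
    then have "openin TX U" "x \<in> U" by simp_all
    from nbhd_TX[OF this] obtain F
      where F: "finite F" "F \<subseteq> \<Omega>" "{y \<in> topspace TX. \<forall>C\<in>F. y C = x C} \<subseteq> U"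
      by (elim exE conjE) (rule that)
    obtain y where y: "y \<in> A" "\<forall>C\<in>F. y C = x C" using r F(1,2) by meson
    then have "y \<in> {y \<in> topspace TX. \<forall>C\<in>F. y C = x C}" using assms by blast
    then show "\<exists>y. y \<in> A \<and> y \<in> U" using F(3) y(1) by blast
  qed
qed

text \<open>The closure in the subspace of permutations is the closure among all functions
  intersected with \<open>sym_cosets G L\<close>. In this form questions about the completion reduce
  to group elements acting on finitely many cosets.\<close>

lemma carrier_S:
  "x \<in> carrier S \<longleftrightarrow> x \<in> sym_cosets G L \<and>
     (\<forall>F. finite F \<longrightarrow> F \<subseteq> \<Omega> \<longrightarrow> (\<exists>g\<in>carrier G. \<forall>C\<in>F. g <# C = x C))"
proof -
  have sub: "sym_cosets G L \<subseteq> topspace TX" by (auto simp: sym_cosets_def)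
  have "carrier S = sym_cosets G L \<inter> TX closure_of (lam ` carrier G)"
    using lam_sym
    by (simp add: schlichting_group_def sym_topology_def closure_of_subtopology_subset
        image_subset_iff Int_absorb1 closure_of_subtopology)
  moreover have "(\<exists>y\<in>lam ` carrier G. \<forall>C\<in>F. y C = x C) \<longleftrightarrow> (\<exists>g\<in>carrier G. \<forall>C\<in>F. g <# C = x C)"
    if "F \<subseteq> \<Omega>" for F
  proof -
    have "(\<forall>C\<in>F. lam g C = x C) \<longleftrightarrow> (\<forall>C\<in>F. g <# C = x C)" for g
      using that by (simp add: subset_iff)
    then show ?thesis by simp
  qed
  moreover have "lam ` carrier G \<subseteq> topspace TX"
    using lam_sym sub by blast
  ultimately show ?thesis
    using sub closure_TX[of "lam ` carrier G" x] by (simp add: subset_iff) meson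
qed

lemma S_approx:
  assumes "x \<in> carrier S" "finite F" "F \<subseteq> \<Omega>"
  shows "\<exists>g\<in>carrier G. \<forall>C\<in>F. g <# C = x C"
  using assms carrier_S by blast

lemma S_in [simp]: "x \<in> carrier S \<Longrightarrow> C \<in> \<Omega> \<Longrightarrow> x C \<in> \<Omega>"
  using carrier_S sym_in by blast

lemma S_eqI:
  assumes "x \<in> carrier S" "y \<in> carrier S" "\<And>C. C \<in> \<Omega> \<Longrightarrow> x C = y C"
  shows "x = y"
  using assms carrier_S sym_ext extensionalityI by metis

lemma lam_S [simp]: "g \<in> carrier G \<Longrightarrow> lam g \<in> carrier S"
  unfolding carrier_S using lam_sym lam_apply by (metis subsetD)

section \<open>Group structure of the completion\<close>

lemma mult_S: "x \<otimes>\<^bsub>S\<^esub> y = restrict (x \<circ> y) \<Omega>"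
  by (simp add: schlichting_group_def)

lemma mult_S_apply [simp]: "C \<in> \<Omega> \<Longrightarrow> (x \<otimes>\<^bsub>S\<^esub> y) C = x (y C)"
  by (simp add: mult_S)

lemma one_S_apply [simp]: "C \<in> \<Omega> \<Longrightarrow> \<one>\<^bsub>S\<^esub> C = C"
  by (simp add: schlichting_group_def)

lemma one_S: "\<one>\<^bsub>S\<^esub> = lam \<one>"
  by (auto simp: schlichting_group_def schlichting_map_def fun_eq_iff)

lemma mult_S_closed: 
  assumes x: "x \<in> carrier S" and y: "y \<in> carrier S" 
  shows "x \<otimes>\<^bsub>S\<^esub> y \<in> carrier S"
  unfolding carrier_S
proof (intro conjI allI impI)
  have "bij_betw (x \<circ> y) \<Omega> \<Omega>"
    using x y carrier_S sym_bij bij_betw_trans[of y \<Omega> \<Omega> x \<Omega>] by simp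
  then have "bij_betw (x \<otimes>\<^bsub>S\<^esub> y) \<Omega> \<Omega>"
    by (rule bij_betw_cong[THEN iffD1, rotated]) simp
  then show "x \<otimes>\<^bsub>S\<^esub> y \<in> sym_cosets G L"
    using x y by (auto simp: sym_cosets_def mult_S)
  fix F assume F: "finite F" "F \<subseteq> \<Omega>"
  obtain k where k: "k \<in> carrier G" "\<forall>C\<in>F. k <# C = y C"
    using S_approx[OF y F] by blast
  \<comment> \<open>The factor \<open>x\<close> has to be matched on the image of \<open>F\<close>
    under \<open>y\<close>.\<close>
  have "finite (y ` F)" "y ` F \<subseteq> \<Omega>" using F y by auto
  then obtain h where h: "h \<in> carrier G" "\<forall>C\<in>y ` F. h <# C = x C"
    using S_approx[OF x] by blast
  show "\<exists>g\<in>carrier G. \<forall>C\<in>F. g <# C = (x \<otimes>\<^bsub>S\<^esub> y) C"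
  proof (intro bexI ballI)
    fix C assume C: "C \<in> F"
    then have "(h \<otimes> k) <# C = h <# (k <# C)" using F h k act_act by (metis subsetD)
    then show "(h \<otimes> k) <# C = (x \<otimes>\<^bsub>S\<^esub> y) C" using C F h k by auto
  qed (use h k in simp)
qed

lemma inverse_S_ex:
  assumes x: "x \<in> carrier S"
  shows "\<exists>y\<in>carrier S. y \<otimes>\<^bsub>S\<^esub> x = \<one>\<^bsub>S\<^esub>"
proof
  let ?y = "restrict (inv_into \<Omega> x) \<Omega>"
  have b: "bij_betw x \<Omega> \<Omega>" using x carrier_S sym_bij by blast
  then have b': "bij_betw (inv_into \<Omega> x) \<Omega> \<Omega>" by (rule bij_betw_inv_into)
  have bin: "inv_into \<Omega> x C \<in> \<Omega>" if "C \<in> \<Omega>" for C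
    using b' that bij_betwE by blast
  show "?y \<otimes>\<^bsub>S\<^esub> x = \<one>\<^bsub>S\<^esub>"
    using x b bij_betw_inv_into_left[OF b]
    by (auto simp: schlichting_group_def fun_eq_iff restrict_def bij_betwE)
  show "?y \<in> carrier S"
    unfolding carrier_S
  proof (intro conjI allI impI)
    have "bij_betw ?y \<Omega> \<Omega>"
      using b' by (rule bij_betw_cong[THEN iffD1, rotated]) simp
    then show "?y \<in> sym_cosets G L"
      using bin by (auto simp: sym_cosets_def)
    fix F assume F: "finite F" "F \<subseteq> \<Omega>"
    \<comment> \<open>Matching \<open>x\<close> on the preimage of \<open>F\<close> makes
      \<open>inv g\<close> match the inverse of \<open>x\<close> on \<open>F\<close>.\<close>
    have "finite (?y ` F)" "?y ` F \<subseteq> \<Omega>" using F bin by auto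
    then obtain g where g: "g \<in> carrier G" "\<forall>C\<in>?y ` F. g <# C = x C"
      using S_approx[OF x] by blast
    show "\<exists>g\<in>carrier G. \<forall>C\<in>F. g <# C = ?y C"
    proof (intro bexI ballI)
      fix C assume C: "C \<in> F"
      then have C': "C \<in> \<Omega>" using F by blast
      have "g <# ?y C = x (?y C)" using g C by blast
      also have "\<dots> = C" using C' b by (simp add: bij_betw_inv_into_right)
      finally show "inv g <# C = ?y C"
        using g C' bin by (metis act_inv(1) restrict_apply')
    qed (use g in simp)
  qed
qed

lemma group_S: "group S"
proof (rule groupI)
  show one: "\<one>\<^bsub>S\<^esub> \<in> carrier S" using one_S by simp
  show "x \<otimes>\<^bsub>S\<^esub> y \<otimes>\<^bsub>S\<^esub> z = x \<otimes>\<^bsub>S\<^esub> (y \<otimes>\<^bsub>S\<^esub> z)"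
    if "x \<in> carrier S" "y \<in> carrier S" "z \<in> carrier S" for x y z
    using that by (intro S_eqI) (auto simp: mult_S_closed)
  show "\<one>\<^bsub>S\<^esub> \<otimes>\<^bsub>S\<^esub> x = x" if "x \<in> carrier S" for x
    using that one by (intro S_eqI) (auto simp: mult_S_closed)
qed (use mult_S_closed inverse_S_ex in auto)

sublocale S: group S by (rule group_S)

lemma inv_S_apply:
  assumes "x \<in> carrier S" "C \<in> \<Omega>"
  shows "(inv\<^bsub>S\<^esub> x) (x C) = C" "x ((inv\<^bsub>S\<^esub> x) C) = C"
  using assms S.l_inv S.r_inv by (metis mult_S_apply one_S_apply)+

lemma lam_mult: "g \<in> carrier G \<Longrightarrow> h \<in> carrier G \<Longrightarrow> lam (g \<otimes> h) = lam g \<otimes>\<^bsub>S\<^esub> lam h"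
  by (intro S_eqI) (auto simp: act_act)

section \<open>Topology of the completion\<close>

lemma TS_eq: "TS = subtopology TX (carrier S)"
proof -
  have "carrier S \<subseteq> sym_cosets G L" using carrier_S by blast
  then show ?thesis
    by (simp add: schlichting_topology_def sym_topology_def subtopology_subtopology Int_absorb1)
qed

lemma carrier_S_TX: "carrier S \<subseteq> topspace TX"
proof
  fix x assume "x \<in> carrier S"
  then have "x \<in> \<Omega> \<rightarrow>\<^sub>E \<Omega>"
    using carrier_S by (simp add: sym_cosets_def)
  then show "x \<in> topspace TX" by simp
qed

lemma topspace_TS [simp]: "topspace TS = carrier S"
  using carrier_S_TX by (auto simp: TS_eq)

lemma openin_TS_agree:
  assumes "finite F" "F \<subseteq> \<Omega>"
  shows "openin TS {y \<in> carrier S. \<forall>C\<in>F. y C = x C}"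
proof -
  have "{y \<in> carrier S. \<forall>C\<in>F. y C = x C} = {y \<in> topspace TX. \<forall>C\<in>F. y C = x C} \<inter> carrier S"
    using carrier_S_TX by blast
  then show ?thesis
    using openin_subtopology_Int[OF openin_TX_agree[OF assms, of x], of "carrier S"]
    by (simp only: TS_eq)
qed

lemma openin_TS_agree1: "C \<in> \<Omega> \<Longrightarrow> openin TS {y \<in> carrier S. y C = D}"
  using openin_TS_agree[of "{C}" "\<lambda>_. D"] by simp

text \<open>The target lies in a product of discrete spaces, so continuity is local constancy of
  each coordinate.\<close>

lemma continuous_into_TS:
  assumes "f \<in> topspace T \<rightarrow> carrier S"
    and "\<And>a C. a \<in> topspace T \<Longrightarrow> C \<in> \<Omega> \<Longrightarrow> \<exists>U. openin T U \<and> a \<in> U \<and> (\<forall>b\<in>U. f b C = f a C)"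
  shows "continuous_map T TS f"
  unfolding TS_eq continuous_map_in_subtopology
proof
  show "f \<in> topspace T \<rightarrow> carrier S" by (rule assms(1))
  show "continuous_map T TX f"
    unfolding continuous_map_componentwise
  proof (intro conjI ballI)
    show "f ` topspace T \<subseteq> extensional \<Omega>"
      using assms(1) carrier_S sym_ext by blast
    fix C assume C: "C \<in> \<Omega>"
    show "continuous_map T (discrete_topology \<Omega>) (\<lambda>a. f a C)"
    proof (rule continuous_map_locally_eq)
      fix a assume a: "a \<in> topspace T"
      then obtain U where "openin T U" "a \<in> U" "\<forall>b\<in>U. f b C = f a C"
        using assms(2) C by blast
      moreover have "continuous_map T (discrete_topology \<Omega>) (\<lambda>_. f a C)"
        using a C S_in[of "f a" C] funcset_mem[OF assms(1) a] by simp
      ultimately show "\<exists>U g. openin T U \<and> a \<in> U \<and> continuous_map T (discrete_topology \<Omega>) g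
          \<and> (\<forall>b\<in>U. f b C = g b)"
        by blast
    qed
  qed
qed

lemma topological_group_S: "topological_group S TS"
  unfolding topological_group_def
proof (intro conjI)
  show "continuous_map (prod_topology TS TS) TS (\<lambda>(x, y). x \<otimes>\<^bsub>S\<^esub> y)"
  proof (rule continuous_into_TS)
    fix a C assume a: "a \<in> topspace (prod_topology TS TS)" and C: "C \<in> \<Omega>"
    then obtain x y where xy: "a = (x, y)" "x \<in> carrier S" "y \<in> carrier S" by auto
    \<comment> \<open>The value of the product at \<open>C\<close> is determined by \<open>y\<close>
      at \<open>C\<close> and by \<open>x\<close> at \<open>y C\<close>.\<close>
    let ?U = "{x' \<in> carrier S. x' (y C) = x (y C)} \<times> {y' \<in> carrier S. y' C = y C}"
    have "openin (prod_topology TS TS) ?U"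
      using xy C openin_TS_agree1 by (simp add: openin_prod_Times_iff)
    moreover have "a \<in> ?U" using xy by simp
    moreover have "\<forall>b\<in>?U. (case b of (x, y) \<Rightarrow> x \<otimes>\<^bsub>S\<^esub> y) C = (case a of (x, y) \<Rightarrow> x \<otimes>\<^bsub>S\<^esub> y) C"
      using xy C by auto
    ultimately show "\<exists>U. openin (prod_topology TS TS) U \<and> a \<in> U \<and>
        (\<forall>b\<in>U. (case b of (x, y) \<Rightarrow> x \<otimes>\<^bsub>S\<^esub> y) C = (case a of (x, y) \<Rightarrow> x \<otimes>\<^bsub>S\<^esub> y) C)"
      by blast
  qed auto
  show "continuous_map TS TS (\<lambda>x. inv\<^bsub>S\<^esub> x)"
  proof (rule continuous_into_TS)
    fix x C assume a: "x \<in> topspace TS" and C: "C \<in> \<Omega>"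
    \<comment> \<open>The inverse of any \<open>y\<close> with \<open>y ?D = C\<close> takes the
      value \<open>?D\<close> at \<open>C\<close>, so prescribing one value of \<open>y\<close>
      suffices.\<close>
    let ?D = "(inv\<^bsub>S\<^esub> x) C"
    have D: "?D \<in> \<Omega>" "x ?D = C" using a C inv_S_apply by auto
    have "openin TS {y \<in> carrier S. y ?D = C}" "x \<in> {y \<in> carrier S. y ?D = C}"
      using D a openin_TS_agree1 by auto
    moreover have "\<forall>y\<in>{y \<in> carrier S. y ?D = C}. (inv\<^bsub>S\<^esub> y) C = ?D"
    proof
      fix y assume "y \<in> {y \<in> carrier S. y ?D = C}"
      then have "y \<in> carrier S" "y ?D = C" by auto
      then show "(inv\<^bsub>S\<^esub> y) C = ?D"
        using inv_S_apply(1)[of y ?D] D(1) by metis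
    qed
    ultimately show "\<exists>U. openin TS U \<and> x \<in> U \<and> (\<forall>y\<in>U. (inv\<^bsub>S\<^esub> y) C = (inv\<^bsub>S\<^esub> x) C)"
      by blast
  qed auto
qed (auto simp: group_S)

section \<open>The compact open stabiliser of the coset \<open>L\<close>\<close>

definition K where "K = {x \<in> carrier S. x L = L}"

lemma act_L_iff: "g \<in> carrier G \<Longrightarrow> g <# L = L \<longleftrightarrow> g \<in> L"
  using l_coset_self_iff[OF L_subgroup] .

lemma finite_L_orbit: "C \<in> \<Omega> \<Longrightarrow> finite ((\<lambda>l. l <# C) ` L)"
  using finite_orbit coset_obtain by (metis Setcompr_eq_image)

text \<open>Surjectivity survives in the closure because the limit permutes each finite \<open>L\<close>-orbit
  injectively.\<close>

lemma compactin_K: "compactin TS K"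
proof -
  let ?O = "\<lambda>C. (\<lambda>l. l <# C) ` L"
  let ?P = "Pi\<^sub>E \<Omega> ?O"
  have Lc: "l \<in> carrier G" if "l \<in> L" for l using L_carrier that by blast
  have Osub: "?O C \<subseteq> \<Omega>" if "C \<in> \<Omega>" for C using that Lc by auto
  \<comment> \<open>This is Tychonoff for the finite \<open>L\<close>-orbits. \<open>K\<close> will
    be the intersection of this product with the closure of the image of \<open>L\<close>.\<close>
  have "compactin TX ?P"
    using finite_L_orbit Osub
    by (simp add: compactin_PiE) (auto simp: compactin_discrete_topology)
  then have "compactin TX (?P \<inter> TX closure_of (lam ` L))"
    by (intro compact_Int_closedin) auto
  moreover have "?P \<inter> TX closure_of (lam ` L) = K"
  proof (intro equalityI subsetI)
    fix x assume x: "x \<in> ?P \<inter> TX closure_of (lam ` L)"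
    have "lam ` L \<subseteq> topspace TX"
      using lam_S Lc carrier_S_TX by blast
    then have appr: "\<exists>l\<in>L. \<forall>C\<in>F. l <# C = x C" if "finite F" "F \<subseteq> \<Omega>" for F
      using x closure_TX that by (fastforce simp: subset_iff)
    have xin: "x C \<in> ?O C" if "C \<in> \<Omega>" for C using x that by blast
    have inj: "inj_on x \<Omega>"
    proof (rule inj_onI)
      fix C C' assume C: "C \<in> \<Omega>" "C' \<in> \<Omega>" "x C = x C'"
      then obtain l where "l \<in> L" "l <# C = x C" "l <# C' = x C'"
        using appr[of "{C, C'}"] by auto
      then show "C = C'" using C act_inj Lc by metis
    qed
    have "\<Omega> \<subseteq> x ` \<Omega>"
    proof
      fix C assume C: "C \<in> \<Omega>"
      have fin: "finite (?O C)" using finite_L_orbit C by blast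
      have "x ` ?O C \<subseteq> ?O C"
      proof clarify
        fix l assume l: "l \<in> L"
        then obtain l' where "l' \<in> L" "x (l <# C) = l' <# (l <# C)"
          using xin[of "l <# C"] C Lc by auto
        then show "x (l <# C) \<in> ?O C"
          using l C Lc act_act subgroup.m_closed[OF L_subgroup] by auto
      qed
      moreover have "inj_on x (?O C)"
        using inj inj_on_subset Osub C by blast
      ultimately have "x ` ?O C = ?O C"
        using endo_inj_surj[OF fin] by simp
      moreover have "C \<in> ?O C"
        by (rule image_eqI[of _ _ \<one>]) (simp_all add: C subgroup.one_closed[OF L_subgroup])
      ultimately have "C \<in> x ` ?O C" by simp
      then show "C \<in> x ` \<Omega>" using image_mono[OF Osub[OF C]] by (rule rev_subsetD)
    qed
    moreover have "x ` \<Omega> \<subseteq> \<Omega>" using xin Osub by (meson image_subsetI subsetD)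
    ultimately have "x \<in> sym_cosets G L"
      using inj x by (auto simp: sym_cosets_def bij_betw_def PiE_iff)
    then have "x \<in> carrier S"
      unfolding carrier_S using appr Lc by meson
    moreover have "x L = L"
      using xin[of L] act_L_iff Lc by auto
    ultimately show "x \<in> K" by (simp add: K_def)
  next
    fix x assume "x \<in> K"
    then have x: "x \<in> carrier S" "x L = L" by (auto simp: K_def)
    have appr: "\<exists>l\<in>L. \<forall>C\<in>F. l <# C = x C" if F: "finite F" "F \<subseteq> \<Omega>" for F
    proof -
      \<comment> \<open>Including \<open>L\<close> among the cosets forces the approximating
        \<open>g\<close> to fix \<open>L\<close>, hence to lie in \<open>L\<close>.\<close>
      obtain g where g: "g \<in> carrier G" "\<forall>C\<in>insert L F. g <# C = x C"
        using S_approx[OF x(1), of "insert L F"] F by auto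
      then have "g \<in> L" using x act_L_iff by (metis insertI1)
      then show ?thesis using g by blast
    qed
    have "x C \<in> ?O C" if "C \<in> \<Omega>" for C
      using appr[of "{C}"] that by auto
    then have "x \<in> ?P"
      using x carrier_S sym_ext by (auto simp: PiE_iff)
    moreover have "lam ` L \<subseteq> topspace TX"
      using lam_S Lc carrier_S_TX by blast
    then have "x \<in> TX closure_of (lam ` L)"
      using closure_TX[of "lam ` L" x] x carrier_S_TX appr by (fastforce simp: subset_iff)
    ultimately show "x \<in> ?P \<inter> TX closure_of (lam ` L)" by blast
  qed
  ultimately show ?thesis
    unfolding TS_eq by (simp add: compactin_subtopology) (simp add: K_def)
qed

lemma locally_compact_group_S: "locally_compact_group S TS"
  unfolding locally_compact_group_def
proof (intro conjI)
  show "topological_group S TS" by (rule topological_group_S)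
  show "Hausdorff_space TS"
    unfolding TS_eq by (intro Hausdorff_space_subtopology) (simp add: Hausdorff_space_product_topology)
  show "locally_compact_space TS"
    unfolding locally_compact_space_def
  proof
    fix x assume x: "x \<in> topspace TS"
    \<comment> \<open>This open set lies in the translate of the compact set \<open>K\<close> by
      \<open>x\<close>.\<close>
    let ?N = "{y \<in> carrier S. y L = x L}"
    have "continuous_map TS TS (\<lambda>y. x \<otimes>\<^bsub>S\<^esub> y)"
      using topological_group_S x by (intro continuous_map_group_mult) auto
    then have "compactin TS ((\<lambda>y. x \<otimes>\<^bsub>S\<^esub> y) ` K)"
      using compactin_K image_compactin by blast
    moreover have "?N \<subseteq> (\<lambda>y. x \<otimes>\<^bsub>S\<^esub> y) ` K"
    proof
      fix y assume y: "y \<in> ?N"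
      have "(inv\<^bsub>S\<^esub> x \<otimes>\<^bsub>S\<^esub> y) L = L" using x y inv_S_apply(1)[of x L] by simp
      then have "inv\<^bsub>S\<^esub> x \<otimes>\<^bsub>S\<^esub> y \<in> K" using x y by (simp add: K_def)
      moreover have "y = x \<otimes>\<^bsub>S\<^esub> (inv\<^bsub>S\<^esub> x \<otimes>\<^bsub>S\<^esub> y)"
        using x y by (simp flip: S.m_assoc)
      ultimately show "y \<in> (\<lambda>y. x \<otimes>\<^bsub>S\<^esub> y) ` K" by blast
    qed
    moreover have "openin TS ?N" using openin_TS_agree1 by simp
    moreover have "x \<in> ?N" using x by simp
    ultimately show "\<exists>U K. openin TS U \<and> compactin TS K \<and> x \<in> U \<and> U \<subseteq> K" by blast
  qed
qed

end

section \<open>The extension attached to an engulfing triple\<close>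

text \<open>Induction along words in \<open>A\<close>: a generator is covered by
  \<open>compat\<close>, an inverse by applying \<open>\<Delta> (inv a)\<close> to it, and for a
  product \<open>u\<close> is first conjugated by \<open>h\<close>. The set of cosets grows with the
  word, so it has to depend on \<open>g\<close>.\<close>

lemma (in finite_orbit_subgroup) compatible_on_generate:
  fixes \<rho> :: "'g \<Rightarrow> 'e" and \<Delta> :: "'g \<Rightarrow> 'e \<Rightarrow> 'e"
  assumes gens: "A \<subseteq> carrier G"
    and mult: "\<And>g h v. \<lbrakk>g \<in> carrier G; h \<in> carrier G; v \<in> V\<rbrakk> \<Longrightarrow> \<Delta> (g \<otimes> h) v = \<Delta> g (\<Delta> h v)"
    and one: "\<And>v. v \<in> V \<Longrightarrow> \<Delta> \<one> v = v"
    and \<rho>: "\<And>h. h \<in> L \<Longrightarrow> \<rho> h \<in> V"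
    and compat: "\<And>a h. \<lbrakk>a \<in> A; h \<in> L\<rbrakk> \<Longrightarrow> \<Delta> a (\<rho> h) = \<rho> (a \<otimes> h \<otimes> inv a)"
    and g: "g \<in> generate G A"
  shows "\<exists>F. finite F \<and> F \<subseteq> \<Omega> \<and> (\<forall>u\<in>carrier G. (\<forall>C\<in>F. u <# C = C) \<longrightarrow>
      u \<in> L \<and> inv g \<otimes> u \<otimes> g \<in> L \<and> \<Delta> g (\<rho> (inv g \<otimes> u \<otimes> g)) = \<rho> u)"
    (is "\<exists>F. ?P g F")
  using g
proof (induction rule: generate.induct)
  case one
  have "?P \<one> {L}"
    using assms(3) \<rho> act_L_iff by auto
  then show ?case by (rule exI[of "?P (\<one>)"])
next
  case (incl a)
  then have a: "a \<in> carrier G" using gens by blast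
  \<comment> \<open>Fixing \<open>L\<close> means \<open>u \<in> L\<close>, and fixing
    \<open>a <# L\<close> means \<open>inv a \<otimes> u \<otimes> a \<in> L\<close>.\<close>
  have "?P a {L, a <# L}"
  proof (intro conjI ballI impI)
    fix u assume u: "u \<in> carrier G" "\<forall>C\<in>{L, a <# L}. u <# C = C"
    then show uL: "u \<in> L" using act_L_iff by simp
    have "(u \<otimes> a) <# L = a <# L" using u a L_in act_act[of u a L] by simp
    then have "inv a \<otimes> (u \<otimes> a) \<in> L"
      using l_coset_eq_iff[OF L_subgroup, of a "u \<otimes> a"] u a by simp
    then show L: "inv a \<otimes> u \<otimes> a \<in> L" using u a by (simp add: m_assoc)
    have "a \<otimes> (inv a \<otimes> u \<otimes> a) \<otimes> inv a = u"
      using u a by (simp add: m_assoc inv_cancel_left)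
    then show "\<Delta> a (\<rho> (inv a \<otimes> u \<otimes> a)) = \<rho> u"
      using compat[OF incl L] by simp
  qed (use a in simp_all)
  then show ?case by (rule exI[of "?P (a)"])
next
  case (inv a)
  then have a: "a \<in> carrier G" using gens by blast
  have "?P (inv a) {L, inv a <# L}"
  proof (intro conjI ballI impI)
    fix u assume u: "u \<in> carrier G" "\<forall>C\<in>{L, inv a <# L}. u <# C = C"
    then show uL: "u \<in> L" using act_L_iff by simp
    have "(u \<otimes> inv a) <# L = inv a <# L" using u a L_in act_act[of u "inv a" L] by simp
    then have "a \<otimes> (u \<otimes> inv a) \<in> L"
      using l_coset_eq_iff[OF L_subgroup, of "inv a" "u \<otimes> inv a"] u a by simp
    then show L: "inv (inv a) \<otimes> u \<otimes> inv a \<in> L" using u a by (simp add: m_assoc)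
    \<comment> \<open>As \<open>u\<close> itself lies in \<open>L\<close>, \<open>compat\<close>
      applies to \<open>u\<close> and is then undone by \<open>\<Delta> (inv a)\<close>.\<close>
    have "\<Delta> (inv a) (\<rho> (a \<otimes> u \<otimes> inv a)) = \<Delta> (inv a) (\<Delta> a (\<rho> u))"
      using compat[OF inv uL] by simp
    also have "\<dots> = \<rho> u"
      using mult[of "inv a" a "\<rho> u"] assms(3) \<rho>[OF uL] a by simp
    finally show "\<Delta> (inv a) (\<rho> (inv (inv a) \<otimes> u \<otimes> inv a)) = \<rho> u"
      using a by simp
  qed (use a in simp_all)
  then show ?case by (rule exI[of "?P (inv a)"])
next
  case (eng h k)
  have hk: "h \<in> carrier G" "k \<in> carrier G"
    using eng generate_incl[OF gens] by auto
  obtain F where F: "?P h F" using eng by blast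
  obtain F' where F': "?P k F'" using eng by blast
  \<comment> \<open>The conjugate \<open>inv h \<otimes> u \<otimes> h\<close> fixes
    \<open>C\<close> exactly when \<open>u\<close> fixes \<open>h <# C\<close>, hence the translate
    of \<open>F'\<close>.\<close>
  have "?P (h \<otimes> k) (F \<union> (\<lambda>C. h <# C) ` F')"
  proof (intro conjI ballI impI)
    show "finite (F \<union> (\<lambda>C. h <# C) ` F')" using F F' by simp
    show "F \<union> (\<lambda>C. h <# C) ` F' \<subseteq> \<Omega>" using F F' hk by auto
    fix u assume u: "u \<in> carrier G" "\<forall>C\<in>F \<union> (\<lambda>C. h <# C) ` F'. u <# C = C"
    let ?u = "inv h \<otimes> u \<otimes> h"
    have 1: "u \<in> L" "?u \<in> L" "\<Delta> h (\<rho> ?u) = \<rho> u"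
      using F u by auto
    have uc: "?u \<in> carrier G" using u hk by simp
    have "?u <# C = C" if "C \<in> F'" for C
    proof -
      have C: "C \<in> \<Omega>" using F' that by blast
      have "?u <# C = inv h <# (u <# (h <# C))"
        using u hk C by (simp add: act_act m_assoc)
      also have "\<dots> = C" using u that hk C by simp
      finally show ?thesis .
    qed
    then have 2: "inv k \<otimes> ?u \<otimes> k \<in> L" "\<Delta> k (\<rho> (inv k \<otimes> ?u \<otimes> k)) = \<rho> ?u"
      using F' uc by auto
    have e: "inv (h \<otimes> k) \<otimes> u \<otimes> (h \<otimes> k) = inv k \<otimes> ?u \<otimes> k"
      using u hk by (simp add: inv_mult_group m_assoc)
    show "u \<in> L" by (rule 1)
    show "inv (h \<otimes> k) \<otimes> u \<otimes> (h \<otimes> k) \<in> L" using e 2 by simp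
    show "\<Delta> (h \<otimes> k) (\<rho> (inv (h \<otimes> k) \<otimes> u \<otimes> (h \<otimes> k))) = \<rho> u"
      using e 1 2 mult[OF hk \<rho>[OF 2(1)]] by simp
  qed
  then show ?case by (rule exI[of "?P (h \<otimes> k)"])
qed

text \<open>The algebraic part of an engulfing triple after \<open>L\<close> has been made small
  enough for the generators; \<open>compatible\<close> has the form of the conclusion of
  \<open>compatible_on_generate\<close>.\<close>

locale engulfed_group = finite_orbit_subgroup G L + E: group E
  for G :: "('g, 'b) monoid_scheme" (structure) and L and E :: "('e, 'f) monoid_scheme" +
  fixes \<rho> :: "'g \<Rightarrow> 'e" and \<Delta> :: "'g \<Rightarrow> 'e \<Rightarrow> 'e"
  assumes rho_hom: "\<rho> \<in> hom (G\<lparr>carrier := L\<rparr>) E"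
    and Delta_hom: "g \<in> carrier G \<Longrightarrow> \<Delta> g \<in> hom E E"
    and Delta_act: "\<lbrakk>g \<in> carrier G; h \<in> carrier G; v \<in> carrier E\<rbrakk> \<Longrightarrow> \<Delta> (g \<otimes> h) v = \<Delta> g (\<Delta> h v)"
    and Delta_one [simp]: "v \<in> carrier E \<Longrightarrow> \<Delta> \<one> v = v"
    and Delta_L: "\<lbrakk>l \<in> L; v \<in> carrier E\<rbrakk> \<Longrightarrow> \<Delta> l v = \<rho> l \<otimes>\<^bsub>E\<^esub> v \<otimes>\<^bsub>E\<^esub> inv\<^bsub>E\<^esub> (\<rho> l)"
    and compatible: "g \<in> carrier G \<Longrightarrow> \<exists>F. finite F \<and> F \<subseteq> \<Omega> \<and> (\<forall>u\<in>carrier G. (\<forall>C\<in>F. u <# C = C) \<longrightarrow>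
      u \<in> L \<and> inv g \<otimes> u \<otimes> g \<in> L \<and> \<Delta> g (\<rho> (inv g \<otimes> u \<otimes> g)) = \<rho> u)"
begin

lemma Lc [simp]: "l \<in> L \<Longrightarrow> l \<in> carrier G"
  using L_carrier by blast

lemma rho_closed [simp]: "l \<in> L \<Longrightarrow> \<rho> l \<in> carrier E"
  using rho_hom by (auto simp: hom_def)

lemma rho_mult: "l \<in> L \<Longrightarrow> m \<in> L \<Longrightarrow> \<rho> (l \<otimes> m) = \<rho> l \<otimes>\<^bsub>E\<^esub> \<rho> m"
  using rho_hom by (auto simp: hom_def)

lemma rho_one [simp]: "\<rho> \<one> = \<one>\<^bsub>E\<^esub>"
proof -
  have "\<one> \<in> L" using L_subgroup subgroup.one_closed by blast
  then have "\<rho> \<one> \<otimes>\<^bsub>E\<^esub> \<rho> \<one> = \<rho> \<one>" using rho_mult[of \<one> \<one>] by simp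
  then show ?thesis using \<open>\<one> \<in> L\<close> by (metis E.r_cancel_one rho_closed)
qed

lemma Delta_closed [simp]: "g \<in> carrier G \<Longrightarrow> v \<in> carrier E \<Longrightarrow> \<Delta> g v \<in> carrier E"
  using Delta_hom by (auto simp: hom_def)

lemma Delta_mult: "\<lbrakk>g \<in> carrier G; v \<in> carrier E; w \<in> carrier E\<rbrakk> \<Longrightarrow> \<Delta> g (v \<otimes>\<^bsub>E\<^esub> w) = \<Delta> g v \<otimes>\<^bsub>E\<^esub> \<Delta> g w"
  using Delta_hom by (auto simp: hom_def)

lemma Delta_id [simp]: "g \<in> carrier G \<Longrightarrow> \<Delta> g \<one>\<^bsub>E\<^esub> = \<one>\<^bsub>E\<^esub>"
  using Delta_mult[of g "\<one>\<^bsub>E\<^esub>" "\<one>\<^bsub>E\<^esub>"] by (metis Delta_closed E.l_one E.one_closed E.r_cancel_one)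

lemma Delta_inv: "g \<in> carrier G \<Longrightarrow> v \<in> carrier E \<Longrightarrow> \<Delta> g (inv\<^bsub>E\<^esub> v) = inv\<^bsub>E\<^esub> (\<Delta> g v)"
  using Delta_mult[of g "inv\<^bsub>E\<^esub> v" v] by (metis Delta_closed Delta_id E.inv_closed E.inv_equality E.l_inv)

section \<open>Coset representatives and the cocycle \<open>t\<close>\<close>

definition rep :: "'g set \<Rightarrow> 'g" where
  "rep C = (if C = L then \<one> else SOME g. g \<in> carrier G \<and> C = g <# L)"

text \<open>This normalisation makes \<open>\<Delta> (rep L)\<close> the identity, so that
  \<open>t\<close> restricts to \<open>\<rho>\<close> on \<open>L\<close> and the identity of the
  completion twists trivially.\<close>

lemma rep_L [simp]: "rep L = \<one>"
  by (simp add: rep_def)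

lemma rep_prop: "C \<in> \<Omega> \<Longrightarrow> rep C \<in> carrier G \<and> C = rep C <# L"
proof (cases "C = L")
  case True
  then show ?thesis using lcos_mult_one[OF L_carrier] by simp
next
  case False
  assume "C \<in> \<Omega>"
  then have "\<exists>g. g \<in> carrier G \<and> C = g <# L" by (auto simp: LCOSETS_def)
  then show ?thesis unfolding rep_def if_not_P[OF False] by (rule someI_ex)
qed

lemma rep_closed [simp]: "C \<in> \<Omega> \<Longrightarrow> rep C \<in> carrier G"
  using rep_prop by blast

text \<open>The \<open>L\<close>-valued cocycle of the section \<open>rep\<close>, characterised by
  \<open>rep_defect\<close>.\<close>

definition defect :: "'g \<Rightarrow> 'g set \<Rightarrow> 'g" where
  "defect h C = inv (rep (h <# C)) \<otimes> (h \<otimes> rep C)"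

lemma defect_L: "h \<in> carrier G \<Longrightarrow> C \<in> \<Omega> \<Longrightarrow> defect h C \<in> L"
proof -
  assume h: "h \<in> carrier G" "C \<in> \<Omega>"
  have "rep (h <# C) <# L = (h \<otimes> rep C) <# L"
    using rep_prop[of "h <# C"] rep_prop[of C] h by (metis act_act act_in L_in)
  then show ?thesis
    using l_coset_eq_iff[OF L_subgroup, of "rep (h <# C)" "h \<otimes> rep C"] h by (simp add: defect_def)
qed

lemma rep_defect: "h \<in> carrier G \<Longrightarrow> C \<in> \<Omega> \<Longrightarrow> rep (h <# C) \<otimes> defect h C = h \<otimes> rep C"
  by (simp add: defect_def flip: m_assoc)

lemma defect_mult:
  "\<lbrakk>h \<in> carrier G; k \<in> carrier G; C \<in> \<Omega>\<rbrakk> \<Longrightarrow> defect (h \<otimes> k) C = defect h (k <# C) \<otimes> defect k C"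
proof -
  assume a: "h \<in> carrier G" "k \<in> carrier G" "C \<in> \<Omega>"
  have "rep ((h \<otimes> k) <# C) \<otimes> (defect h (k <# C) \<otimes> defect k C)
      = rep (h <# (k <# C)) \<otimes> defect h (k <# C) \<otimes> defect k C"
    using a defect_L by (simp add: act_act m_assoc)
  also have "\<dots> = h \<otimes> (rep (k <# C) \<otimes> defect k C)"
    using a defect_L by (simp add: rep_defect m_assoc)
  also have "\<dots> = h \<otimes> k \<otimes> rep C"
    using a by (simp add: rep_defect m_assoc)
  also have "\<dots> = rep ((h \<otimes> k) <# C) \<otimes> defect (h \<otimes> k) C"
    using a by (simp add: rep_defect)
  finally show ?thesis
    using a defect_L by (simp add: subgroup.m_closed[OF L_subgroup])
qed

text \<open>Reading \<open>\<Delta> g (\<rho> l)\<close> as \<open>\<rho> (g l inv g)\<close> even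
  where the conjugate leaves \<open>L\<close>, this is the formal value of \<open>\<rho>\<close> at
  \<open>h rep(C) inv (rep (hC))\<close>. The cocycle rule \<open>t_mult\<close> is formally
  multiplicativity of \<open>\<rho>\<close>.\<close>

definition t :: "'g \<Rightarrow> 'g set \<Rightarrow> 'e" where
  "t h C = \<Delta> (rep (h <# C)) (\<rho> (defect h C))"

lemma t_closed [simp]: "h \<in> carrier G \<Longrightarrow> C \<in> \<Omega> \<Longrightarrow> t h C \<in> carrier E"
  by (simp add: t_def defect_L)

text \<open>This combines \<open>rep_defect\<close> with the fact that \<open>\<Delta>\<close> of an
  element of \<open>L\<close>, here the defect, is conjugation by its
  \<open>\<rho>\<close>-image.\<close>

lemma t_conj:
  assumes h: "h \<in> carrier G" and C: "C \<in> \<Omega>" and w: "w \<in> carrier E"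
  shows "\<Delta> h (\<Delta> (rep C) w) \<otimes>\<^bsub>E\<^esub> t h C = t h C \<otimes>\<^bsub>E\<^esub> \<Delta> (rep (h <# C)) w"
proof -
  let ?R = "rep (h <# C)" and ?a = "defect h C"
  have a: "?a \<in> L" using h C by (rule defect_L)
  have "\<Delta> h (\<Delta> (rep C) w) = \<Delta> (?R \<otimes> ?a) w"
    using assms by (simp add: rep_defect Delta_act)
  also have "\<dots> = \<Delta> ?R (\<rho> ?a \<otimes>\<^bsub>E\<^esub> w \<otimes>\<^bsub>E\<^esub> inv\<^bsub>E\<^esub> (\<rho> ?a))"
    using assms a by (simp add: Delta_act Delta_L)
  finally have "\<Delta> h (\<Delta> (rep C) w) \<otimes>\<^bsub>E\<^esub> t h C = \<Delta> ?R (\<rho> ?a \<otimes>\<^bsub>E\<^esub> w \<otimes>\<^bsub>E\<^esub> inv\<^bsub>E\<^esub> (\<rho> ?a) \<otimes>\<^bsub>E\<^esub> \<rho> ?a)"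
    using assms a by (simp add: t_def Delta_mult)
  also have "\<rho> ?a \<otimes>\<^bsub>E\<^esub> w \<otimes>\<^bsub>E\<^esub> inv\<^bsub>E\<^esub> (\<rho> ?a) \<otimes>\<^bsub>E\<^esub> \<rho> ?a = \<rho> ?a \<otimes>\<^bsub>E\<^esub> w"
    using w a by (simp add: E.m_assoc)
  finally show ?thesis using assms a by (simp add: t_def Delta_mult)
qed

text \<open>\<open>t_conj\<close> with \<open>w = \<rho> (defect k C)\<close> moves
  \<open>t h (k <# C)\<close> to the left, and the defects then multiply by
  \<open>defect_mult\<close>.\<close>

lemma t_mult:
  assumes h: "h \<in> carrier G" and k: "k \<in> carrier G" and C: "C \<in> \<Omega>"
  shows "t (h \<otimes> k) C = \<Delta> h (t k C) \<otimes>\<^bsub>E\<^esub> t h (k <# C)"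
proof -
  have "\<Delta> h (t k C) \<otimes>\<^bsub>E\<^esub> t h (k <# C)
      = t h (k <# C) \<otimes>\<^bsub>E\<^esub> \<Delta> (rep (h <# (k <# C))) (\<rho> (defect k C))"
    using t_conj[OF h act_in[OF k C], of "\<rho> (defect k C)"] defect_L[OF k C] by (simp add: t_def)
  also have "\<dots> = \<Delta> (rep (h <# (k <# C))) (\<rho> (defect (h \<otimes> k) C))"
    using assms defect_L by (simp add: t_def Delta_mult defect_mult rho_mult)
  finally show ?thesis using assms by (simp add: t_def act_act)
qed

lemma t_L: "l \<in> L \<Longrightarrow> t l L = \<rho> l"
  using act_L_iff[of l] by (simp add: t_def defect_def)

lemma t_one: "C \<in> \<Omega> \<Longrightarrow> t \<one> C = \<one>\<^bsub>E\<^esub>"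
  by (simp add: t_def defect_def)

section \<open>Extending the quotients of \<open>t\<close> to the completion\<close>

definition good :: "'g set \<Rightarrow> 'g set set \<Rightarrow> bool" where
  "good C F \<longleftrightarrow> finite F \<and> F \<subseteq> \<Omega> \<and> L \<in> F \<and> C \<in> F \<and>
     (\<forall>u\<in>carrier G. (\<forall>D\<in>F. u <# D = D) \<longrightarrow> u \<in> L \<and> t u C = \<rho> u)"

text \<open>One set per coset, fixed once, so that \<open>\<sigma>\<close> depends on prescribed
  finitely many values. Its members \<open>L\<close> and \<open>C\<close> ensure that agreement on
  it determines \<open>h <# L\<close> and \<open>h <# C\<close>.\<close>

definition FF :: "'g set \<Rightarrow> 'g set set" where
  "FF C = (SOME F. good C F)"

lemma good_FF: assumes C: "C \<in> \<Omega>" shows "good C (FF C)"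
proof -
  obtain F where F: "finite F" "F \<subseteq> \<Omega>" "\<forall>u\<in>carrier G. (\<forall>D\<in>F. u <# D = D) \<longrightarrow>
      u \<in> L \<and> inv (rep C) \<otimes> u \<otimes> rep C \<in> L \<and> \<Delta> (rep C) (\<rho> (inv (rep C) \<otimes> u \<otimes> rep C)) = \<rho> u"
    using compatible[OF rep_closed[OF C]] by blast
  have "good C (insert L (insert C F))"
    unfolding good_def
  proof (intro conjI ballI impI)
    fix u assume u: "u \<in> carrier G" "\<forall>D\<in>insert L (insert C F). u <# D = D"
    then show "u \<in> L" using F by simp
    \<comment> \<open>As \<open>u\<close> fixes \<open>C\<close>, its defect at \<open>C\<close> is
      a conjugate by \<open>rep C\<close>, so the relation for \<open>g = rep C\<close>
      applies.\<close>
    have "t u C = \<Delta> (rep C) (\<rho> (inv (rep C) \<otimes> u \<otimes> rep C))"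
      using u C by (simp add: t_def defect_def m_assoc)
    then show "t u C = \<rho> u" using F u by simp
  qed (use F C in auto)
  then show ?thesis unfolding FF_def by (rule someI)
qed

lemma FF: assumes "C \<in> \<Omega>"
  shows "finite (FF C)" "FF C \<subseteq> \<Omega>" "L \<in> FF C" "C \<in> FF C"
    and "\<And>u. u \<in> carrier G \<Longrightarrow> \<forall>D\<in>FF C. u <# D = D \<Longrightarrow> u \<in> L \<and> t u C = \<rho> u"
  using good_FF[OF assms] unfolding good_def by blast+

text \<open>Write \<open>h' = h u\<close> with \<open>u\<close> fixing \<open>FF C\<close>: both \<open>t h L\<close> and \<open>t h C\<close> are then multiplied from the
  left by the same factor \<open>\<Delta> h (\<rho> u)\<close>.\<close>

lemma t_quotient_indep:
  assumes h: "h \<in> carrier G" and h': "h' \<in> carrier G" and C: "C \<in> \<Omega>"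
    and agree: "\<forall>D\<in>FF C. h <# D = h' <# D"
  shows "inv\<^bsub>E\<^esub> (t h L) \<otimes>\<^bsub>E\<^esub> t h C = inv\<^bsub>E\<^esub> (t h' L) \<otimes>\<^bsub>E\<^esub> t h' C"
proof -
  let ?u = "inv h \<otimes> h'"
  have u: "?u \<in> carrier G" "h' = h \<otimes> ?u" using h h' by (simp_all flip: m_assoc)
  have "?u <# D = D" if "D \<in> FF C" for D
  proof -
    have D: "D \<in> \<Omega>" using FF(2)[OF C] that by blast
    have "?u <# D = inv h <# (h' <# D)" using h h' D by (simp add: act_act)
    also have "\<dots> = inv h <# (h <# D)" using agree that by simp
    finally show ?thesis using h D by simp
  qed
  then have fx: "\<forall>D\<in>FF C. ?u <# D = D" by blast
  then have uL: "?u \<in> L" "t ?u C = \<rho> ?u" "?u <# L = L" "?u <# C = C"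
    using FF[OF C] u by blast+
  let ?p = "\<Delta> h (\<rho> ?u)"
  have p: "?p \<in> carrier E" using h uL by simp
  have "t h' L = ?p \<otimes>\<^bsub>E\<^esub> t h L" "t h' C = ?p \<otimes>\<^bsub>E\<^esub> t h C"
    using t_mult[OF h u(1) L_in] t_mult[OF h u(1) C] uL t_L[OF uL(1)] u(2) by simp_all
  moreover have "inv\<^bsub>E\<^esub> (?p \<otimes>\<^bsub>E\<^esub> t h L) \<otimes>\<^bsub>E\<^esub> (?p \<otimes>\<^bsub>E\<^esub> t h C) = inv\<^bsub>E\<^esub> (t h L) \<otimes>\<^bsub>E\<^esub> t h C"
    using p h C by (simp add: E.inv_mult_group E.m_assoc E.inv_cancel_left)
  ultimately show ?thesis using p h C by simp
qed

text \<open>By \<open>t_quotient_indep\<close> the choice of \<open>h\<close> does not matter.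
  Dividing by \<open>t h L\<close> removes the factor \<open>\<Delta> h (\<rho> u)\<close> that
  \<open>t h C\<close> acquires when \<open>h\<close> is replaced by \<open>h u\<close>.\<close>

definition \<sigma> :: "('g set \<Rightarrow> 'g set) \<Rightarrow> 'g set \<Rightarrow> 'e" where
  "\<sigma> x C = (let h = SOME h. h \<in> carrier G \<and> (\<forall>D\<in>FF C. h <# D = x D) in inv\<^bsub>E\<^esub> (t h L) \<otimes>\<^bsub>E\<^esub> t h C)"

lemma \<sigma>_eq:
  assumes x: "x \<in> carrier S" and C: "C \<in> \<Omega>" and h: "h \<in> carrier G" "\<forall>D\<in>FF C. h <# D = x D"
  shows "\<sigma> x C = inv\<^bsub>E\<^esub> (t h L) \<otimes>\<^bsub>E\<^esub> t h C"
proof -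
  let ?h = "SOME h. h \<in> carrier G \<and> (\<forall>D\<in>FF C. h <# D = x D)"
  have "?h \<in> carrier G \<and> (\<forall>D\<in>FF C. ?h <# D = x D)"
    using h by (intro someI[of "\<lambda>h. h \<in> carrier G \<and> (\<forall>D\<in>FF C. h <# D = x D)" h]) simp
  then show ?thesis
    using t_quotient_indep[of ?h h C] h C by (simp add: \<sigma>_def Let_def)
qed

text \<open>The additional set \<open>F\<close> lets one group element compute several values of
  \<open>\<sigma>\<close> at the same time.\<close>

lemma \<sigma>_approx:
  assumes "x \<in> carrier S" "C \<in> \<Omega>" "finite F" "F \<subseteq> \<Omega>"
  shows "\<exists>h\<in>carrier G. (\<forall>D\<in>FF C \<union> F. h <# D = x D) \<and> \<sigma> x C = inv\<^bsub>E\<^esub> (t h L) \<otimes>\<^bsub>E\<^esub> t h C"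
proof -
  obtain h where "h \<in> carrier G" "\<forall>D\<in>FF C \<union> F. h <# D = x D"
    using S_approx[OF assms(1), of "FF C \<union> F"] FF[OF assms(2)] assms(3,4) by auto
  then show ?thesis using \<sigma>_eq[OF assms(1,2)] by blast
qed

lemma \<sigma>_closed [simp]: "x \<in> carrier S \<Longrightarrow> C \<in> \<Omega> \<Longrightarrow> \<sigma> x C \<in> carrier E"
  using \<sigma>_approx[of x C "{}"] by auto

lemma \<sigma>_L [simp]: "x \<in> carrier S \<Longrightarrow> \<sigma> x L = \<one>\<^bsub>E\<^esub>"
  using \<sigma>_approx[of x L "{}"] by auto

lemma \<sigma>_lam: "g \<in> carrier G \<Longrightarrow> C \<in> \<Omega> \<Longrightarrow> \<sigma> (lam g) C = inv\<^bsub>E\<^esub> (t g L) \<otimes>\<^bsub>E\<^esub> t g C"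
  using \<sigma>_eq[of "lam g" C g] FF(2) by (auto simp: subset_iff)

lemma \<sigma>_one [simp]: "C \<in> \<Omega> \<Longrightarrow> \<sigma> \<one>\<^bsub>S\<^esub> C = \<one>\<^bsub>E\<^esub>"
  by (simp add: one_S \<sigma>_lam t_one)

text \<open>This is \<open>t_conj\<close> at the coset \<open>L\<close>, where \<open>rep L\<close>
  drops out, rearranged so that a twisted element passes across the inverse of
  \<open>t h L\<close>.\<close>

lemma conj_move:
  assumes h: "h \<in> carrier G" and w: "w \<in> carrier E" and b: "b \<in> carrier E"
  shows "\<Delta> (rep (h <# L)) w \<otimes>\<^bsub>E\<^esub> (inv\<^bsub>E\<^esub> (t h L) \<otimes>\<^bsub>E\<^esub> b) = inv\<^bsub>E\<^esub> (t h L) \<otimes>\<^bsub>E\<^esub> (\<Delta> h w \<otimes>\<^bsub>E\<^esub> b)"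
proof -
  let ?A = "t h L" and ?d = "\<Delta> (rep (h <# L)) w"
  have [simp]: "?A \<in> carrier E" "?d \<in> carrier E" "\<Delta> h w \<in> carrier E"
    using assms by auto
  have "\<Delta> h w \<otimes>\<^bsub>E\<^esub> ?A = ?A \<otimes>\<^bsub>E\<^esub> ?d"
    using t_conj[OF h L_in w] w by simp
  then have "inv\<^bsub>E\<^esub> ?A \<otimes>\<^bsub>E\<^esub> (\<Delta> h w \<otimes>\<^bsub>E\<^esub> ?A) \<otimes>\<^bsub>E\<^esub> (inv\<^bsub>E\<^esub> ?A \<otimes>\<^bsub>E\<^esub> b) = ?d \<otimes>\<^bsub>E\<^esub> (inv\<^bsub>E\<^esub> ?A \<otimes>\<^bsub>E\<^esub> b)"
    using b by (simp flip: E.m_assoc)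
  moreover have "inv\<^bsub>E\<^esub> ?A \<otimes>\<^bsub>E\<^esub> (\<Delta> h w \<otimes>\<^bsub>E\<^esub> ?A) \<otimes>\<^bsub>E\<^esub> (inv\<^bsub>E\<^esub> ?A \<otimes>\<^bsub>E\<^esub> b) = inv\<^bsub>E\<^esub> ?A \<otimes>\<^bsub>E\<^esub> (\<Delta> h w \<otimes>\<^bsub>E\<^esub> b)"
    using b by (simp add: E.m_assoc E.inv_cancel_left)
  ultimately show ?thesis by simp
qed

lemma \<sigma>_twist:
  assumes x: "x \<in> carrier S" and C: "C \<in> \<Omega>" and v: "v \<in> carrier E"
  shows "\<Delta> (rep (x L)) (\<Delta> (rep C) v) \<otimes>\<^bsub>E\<^esub> \<sigma> x C = \<sigma> x C \<otimes>\<^bsub>E\<^esub> \<Delta> (rep (x C)) v"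
proof -
  obtain h where h: "h \<in> carrier G" "\<forall>D\<in>FF C. h <# D = x D" "\<sigma> x C = inv\<^bsub>E\<^esub> (t h L) \<otimes>\<^bsub>E\<^esub> t h C"
    using \<sigma>_approx[OF x C, of "{}"] by auto
  have e: "x L = h <# L" "x C = h <# C" using h(2) FF(3,4)[OF C] by simp_all
  have "\<Delta> (rep (x L)) (\<Delta> (rep C) v) \<otimes>\<^bsub>E\<^esub> \<sigma> x C = inv\<^bsub>E\<^esub> (t h L) \<otimes>\<^bsub>E\<^esub> (\<Delta> h (\<Delta> (rep C) v) \<otimes>\<^bsub>E\<^esub> t h C)"
    using conj_move[OF h(1), of "\<Delta> (rep C) v" "t h C"] h C v e by simp
  also have "\<dots> = inv\<^bsub>E\<^esub> (t h L) \<otimes>\<^bsub>E\<^esub> (t h C \<otimes>\<^bsub>E\<^esub> \<Delta> (rep (h <# C)) v)"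
    using t_conj h C v by simp
  finally show ?thesis using h C v e by (simp add: E.m_assoc)
qed

lemma \<sigma>_cocycle:
  assumes x: "x \<in> carrier S" and y: "y \<in> carrier S" and C: "C \<in> \<Omega>"
  shows "\<Delta> (rep (x L)) (\<sigma> y C) \<otimes>\<^bsub>E\<^esub> \<sigma> x (y C) = \<sigma> x (y L) \<otimes>\<^bsub>E\<^esub> \<sigma> (x \<otimes>\<^bsub>S\<^esub> y) C"
proof -
  obtain k where k: "k \<in> carrier G" "\<forall>D\<in>FF C. k <# D = y D" "\<sigma> y C = inv\<^bsub>E\<^esub> (t k L) \<otimes>\<^bsub>E\<^esub> t k C"
    using \<sigma>_approx[OF y C, of "{}"] by auto
  have yC: "y C \<in> \<Omega>" "y L \<in> \<Omega>" using y C by auto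
  \<comment> \<open>Agreement on \<open>FF (y L)\<close> lets the same \<open>h\<close> compute
    \<open>\<sigma> x (y L)\<close>, and agreement on the image of \<open>FF C\<close> under
    \<open>y\<close> makes \<open>h \<otimes> k\<close> agree with the product of \<open>x\<close>
    and \<open>y\<close> on \<open>FF C\<close>.\<close>
  let ?F = "FF (y L) \<union> y ` FF C"
  have "finite ?F" "?F \<subseteq> \<Omega>" using FF(1,2)[OF C] FF(1,2)[OF yC(2)] y by auto
  then obtain h where h: "h \<in> carrier G" "\<forall>D\<in>FF (y C) \<union> ?F. h <# D = x D"
      "\<sigma> x (y C) = inv\<^bsub>E\<^esub> (t h L) \<otimes>\<^bsub>E\<^esub> t h (y C)"
    using \<sigma>_approx[OF x yC(1), of ?F] by blast
  have hL: "\<sigma> x (y L) = inv\<^bsub>E\<^esub> (t h L) \<otimes>\<^bsub>E\<^esub> t h (y L)"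
    using \<sigma>_eq[OF x yC(2) h(1)] h(2) by blast
  have "(h \<otimes> k) <# D = (x \<otimes>\<^bsub>S\<^esub> y) D" if "D \<in> FF C" for D
  proof -
    have "D \<in> \<Omega>" using that FF(2)[OF C] by blast
    then have "(h \<otimes> k) <# D = h <# (k <# D)" using h k by (simp add: act_act)
    then show ?thesis using that h k \<open>D \<in> \<Omega>\<close> by auto
  qed
  then have hk: "\<sigma> (x \<otimes>\<^bsub>S\<^esub> y) C = inv\<^bsub>E\<^esub> (t (h \<otimes> k) L) \<otimes>\<^bsub>E\<^esub> t (h \<otimes> k) C"
    using \<sigma>_eq[of "x \<otimes>\<^bsub>S\<^esub> y" C "h \<otimes> k"] x y C h(1) k(1) mult_S_closed by blast
  have e: "x L = h <# L" "y L = k <# L" "y C = k <# C"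
    using h(2) k(2) FF(3,4)[OF C] FF(3)[OF yC(1)] by simp_all
  note [simp] = h(1) k(1) C
  let ?A = "t h L" and ?B = "t h (k <# L)" and ?C = "t h (k <# C)" and ?p = "\<Delta> h (t k L)"
  have "\<Delta> (rep (x L)) (\<sigma> y C) \<otimes>\<^bsub>E\<^esub> \<sigma> x (y C) = inv\<^bsub>E\<^esub> ?A \<otimes>\<^bsub>E\<^esub> (\<Delta> h (inv\<^bsub>E\<^esub> (t k L) \<otimes>\<^bsub>E\<^esub> t k C) \<otimes>\<^bsub>E\<^esub> ?C)"
    using conj_move[OF h(1), of "inv\<^bsub>E\<^esub> (t k L) \<otimes>\<^bsub>E\<^esub> t k C" ?C] h(3) k(3) e by simp
  also have "\<dots> = inv\<^bsub>E\<^esub> ?A \<otimes>\<^bsub>E\<^esub> (inv\<^bsub>E\<^esub> ?p \<otimes>\<^bsub>E\<^esub> (\<Delta> h (t k C) \<otimes>\<^bsub>E\<^esub> ?C))"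
    by (simp add: Delta_mult Delta_inv E.m_assoc)
  \<comment> \<open>\<open>?B\<close> and its inverse are inserted because \<open>t_mult\<close>
    identifies the product of \<open>?p\<close> and \<open>?B\<close> with
    \<open>t (h \<otimes> k) L\<close>.\<close>
  also have "\<dots> = (inv\<^bsub>E\<^esub> ?A \<otimes>\<^bsub>E\<^esub> ?B) \<otimes>\<^bsub>E\<^esub> (inv\<^bsub>E\<^esub> (?p \<otimes>\<^bsub>E\<^esub> ?B) \<otimes>\<^bsub>E\<^esub> (\<Delta> h (t k C) \<otimes>\<^bsub>E\<^esub> ?C))"
    by (simp add: E.inv_mult_group E.m_assoc E.inv_cancel_left)
  also have "\<dots> = \<sigma> x (y L) \<otimes>\<^bsub>E\<^esub> \<sigma> (x \<otimes>\<^bsub>S\<^esub> y) C"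
    using t_mult[OF h(1) k(1)] hL hk e by simp
  finally show ?thesis .
qed

section \<open>The factor set and the homomorphism into the extension\<close>

sublocale factor_set E S "\<lambda>x. \<Delta> (rep (x L))" "\<lambda>x y. \<sigma> x (y L)"
proof
  fix x y z v
  assume x: "x \<in> carrier S"
  show "\<Delta> (rep (x L)) \<in> hom E E"
    using x by (intro Delta_hom rep_closed) simp
  show "\<sigma> x (\<one>\<^bsub>S\<^esub> L) = \<one>\<^bsub>E\<^esub>" using x by simp
  show "\<sigma> \<one>\<^bsub>S\<^esub> (x L) = \<one>\<^bsub>E\<^esub>" using x by simp
  assume y: "y \<in> carrier S"
  show "\<sigma> x (y L) \<in> carrier E" using x y by simp
  show "\<Delta> (rep (x L)) (\<Delta> (rep (y L)) v) \<otimes>\<^bsub>E\<^esub> \<sigma> x (y L) = \<sigma> x (y L) \<otimes>\<^bsub>E\<^esub> \<Delta> (rep ((x \<otimes>\<^bsub>S\<^esub> y) L)) v"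
    if "v \<in> carrier E"
    using \<sigma>_twist[of x "y L"] x y that by simp
  show "\<Delta> (rep (x L)) (\<sigma> y (z L)) \<otimes>\<^bsub>E\<^esub> \<sigma> x ((y \<otimes>\<^bsub>S\<^esub> z) L) = \<sigma> x (y L) \<otimes>\<^bsub>E\<^esub> \<sigma> (x \<otimes>\<^bsub>S\<^esub> y) (z L)"
    if "z \<in> carrier S"
    using \<sigma>_cocycle[of x y "z L"] x y that by simp
qed simp

text \<open>The factor set is made for this map: conjugation by
  \<open>s(lam g) = inv (t g L) \<gamma> g\<close> is \<open>\<Delta> (rep (g <# L))\<close> by
  \<open>t_conj\<close>, and \<open>s(lam g) s(lam h)\<close> differs from
  \<open>s(lam (gh))\<close> by \<open>\<sigma> (lam g) (h <# L)\<close> by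
  \<open>t_mult\<close>.\<close>

definition \<gamma> :: "'g \<Rightarrow> 'e \<times> ('g set \<Rightarrow> 'g set)" where
  "\<gamma> g = (t g L, lam g)"

lemma \<gamma>_hom: "\<gamma> \<in> hom G P"
proof (rule homI)
  fix g h assume g: "g \<in> carrier G" and h: "h \<in> carrier G"
  have m: "h <# L \<in> \<Omega>" "t g L \<in> carrier E" "t g (h <# L) \<in> carrier E" "t h L \<in> carrier E"
    using g h by auto
  have "t g L \<otimes>\<^bsub>E\<^esub> \<Delta> (rep (g <# L)) (t h L) = \<Delta> g (t h L) \<otimes>\<^bsub>E\<^esub> t g L"
    using t_conj[OF g L_in m(4)] m by simp
  then have "t g L \<otimes>\<^bsub>E\<^esub> \<Delta> (rep (g <# L)) (t h L) \<otimes>\<^bsub>E\<^esub> (inv\<^bsub>E\<^esub> (t g L) \<otimes>\<^bsub>E\<^esub> t g (h <# L))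
      = \<Delta> g (t h L) \<otimes>\<^bsub>E\<^esub> t g (h <# L)"
    using m g h by (simp add: E.m_assoc E.inv_cancel_left)
  also have "\<dots> = t (g \<otimes> h) L"
    using m g h by (simp add: t_mult)
  finally show "\<gamma> (g \<otimes> h) = \<gamma> g \<otimes>\<^bsub>P\<^esub> \<gamma> h"
    using g h by (simp add: \<gamma>_def lam_mult \<sigma>_lam)
qed (simp add: \<gamma>_def)

lemma \<gamma>_conj:
  assumes g: "g \<in> carrier G" and v: "v \<in> carrier E"
  shows "(\<Delta> g v, \<one>\<^bsub>S\<^esub>) = \<gamma> g \<otimes>\<^bsub>P\<^esub> (v, \<one>\<^bsub>S\<^esub>) \<otimes>\<^bsub>P\<^esub> inv\<^bsub>P\<^esub> (\<gamma> g)"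
proof -
  interpret P: group P by (rule group_P)
  \<comment> \<open>The conjugation formula with the inverse cleared is \<open>t_conj\<close> at the
    coset \<open>L\<close>.\<close>
  have "(\<Delta> g v, \<one>\<^bsub>S\<^esub>) \<otimes>\<^bsub>P\<^esub> \<gamma> g = \<gamma> g \<otimes>\<^bsub>P\<^esub> (v, \<one>\<^bsub>S\<^esub>)"
    using t_conj[OF g L_in v] g v by (simp add: \<gamma>_def)
  moreover have "\<gamma> g \<in> carrier P" "(v, \<one>\<^bsub>S\<^esub>) \<in> carrier P" "(\<Delta> g v, \<one>\<^bsub>S\<^esub>) \<in> carrier P"
    using g v by (simp_all add: \<gamma>_def)
  ultimately show ?thesis
    by (metis P.inv_solve_right P.m_closed)
qed

end

text \<open>The lattice condition on \<open>\<rho>\<close> is put in pointwise form: an isolated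
  identity, and a compact set meeting every left coset of the image of \<open>L\<close>.\<close>

locale engulfed_lattice = engulfed_group G L E \<rho> \<Delta>
  for G :: "('g, 'b) monoid_scheme" (structure) and L and E :: "('e, 'f) monoid_scheme"
    and \<rho> :: "'g \<Rightarrow> 'e" and \<Delta> :: "'g \<Rightarrow> 'e \<Rightarrow> 'e" +
  fixes TE :: "'e topology"
  assumes lcE: "locally_compact_group E TE"
    and Delta_continuous: "g \<in> carrier G \<Longrightarrow> continuous_map TE TE (\<Delta> g)"
    and rho_kernel: "finite {l \<in> L. \<rho> l = \<one>\<^bsub>E\<^esub>}"
    and rho_discrete: "\<exists>V. openin TE V \<and> \<one>\<^bsub>E\<^esub> \<in> V \<and> (\<forall>l\<in>L. \<rho> l \<in> V \<longrightarrow> \<rho> l = \<one>\<^bsub>E\<^esub>)"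
    and rho_cocompact: "\<exists>M. compactin TE M \<and> (\<forall>v\<in>carrier E. \<exists>l\<in>L. v \<otimes>\<^bsub>E\<^esub> \<rho> l \<in> M)"
begin

sublocale topological_factor_set E S "\<lambda>x. \<Delta> (rep (x L))" "\<lambda>x y. \<sigma> x (y L)" TE TS
proof
  show "locally_compact_group E TE" by (rule lcE)
  show "locally_compact_group S TS" by (rule locally_compact_group_S)
  fix x assume x: "x \<in> carrier S"
  show "continuous_map TE TE (\<Delta> (rep (x L)))"
    using x by (intro Delta_continuous rep_closed) simp
  have o: "openin TS {x' \<in> carrier S. x' L = x L}" using openin_TS_agree1 by simp
  show "\<exists>U. openin TS U \<and> x \<in> U \<and> (\<forall>x'\<in>U. \<forall>v\<in>carrier E. \<Delta> (rep (x' L)) v = \<Delta> (rep (x L)) v)"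
    using o x by (intro exI[of _ "{x' \<in> carrier S. x' L = x L}"]) simp
  fix y assume y: "y \<in> carrier S"
  have C: "y L \<in> \<Omega>" using y by simp
  \<comment> \<open>All \<open>x'\<close> in \<open>?U\<close> agree with \<open>x\<close> on
    \<open>FF (y L)\<close>, so one \<open>h\<close> computes all their values of
    \<open>\<sigma>\<close> at \<open>y L\<close>.\<close>
  let ?U = "{x' \<in> carrier S. \<forall>D\<in>FF (y L). x' D = x D}" and ?V = "{y' \<in> carrier S. y' L = y L}"
  obtain h where h: "h \<in> carrier G" "\<forall>D\<in>FF (y L). h <# D = x D"
    using S_approx[OF x FF(1,2)[OF C]] by blast
  have "\<sigma> x' (y' L) = \<sigma> x (y L)" if "x' \<in> ?U" "y' \<in> ?V" for x' y'
    using \<sigma>_eq[OF x C h] \<sigma>_eq[of x' "y L" h] that C h by simp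
  moreover have "openin TS ?U" "openin TS ?V"
    using openin_TS_agree[OF FF(1,2)[OF C]] openin_TS_agree1 by auto
  moreover have "x \<in> ?U" "y \<in> ?V" using x y by auto
  ultimately have "openin TS ?U \<and> openin TS ?V \<and> x \<in> ?U \<and> y \<in> ?V \<and>
      (\<forall>x'\<in>?U. \<forall>y'\<in>?V. \<sigma> x' (y' L) = \<sigma> x (y L))"
    by (intro conjI ballI)
  then show "\<exists>U V. openin TS U \<and> openin TS V \<and> x \<in> U \<and> y \<in> V \<and>
      (\<forall>x'\<in>U. \<forall>y'\<in>V. \<sigma> x' (y' L) = \<sigma> x (y L))"
    by (intro exI[of _ ?U] exI[of _ ?V])
qed

section \<open>Finite kernel, discreteness and cocompactness of \<open>\<gamma>\<close>\<close>

lemma \<gamma>_kernel: "finite {g \<in> carrier G. \<gamma> g = \<one>\<^bsub>P\<^esub>}"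
proof (rule finite_subset[OF _ rho_kernel])
  show "{g \<in> carrier G. \<gamma> g = \<one>\<^bsub>P\<^esub>} \<subseteq> {l \<in> L. \<rho> l = \<one>\<^bsub>E\<^esub>}"
  proof clarify
    fix g assume g: "g \<in> carrier G" "\<gamma> g = \<one>\<^bsub>P\<^esub>"
    then have e: "t g L = \<one>\<^bsub>E\<^esub>" "lam g = \<one>\<^bsub>S\<^esub>" by (simp_all add: \<gamma>_def)
    then have "g <# L = L" using lam_apply[OF L_in, of g] one_S_apply[OF L_in] by simp
    then have "g \<in> L" using act_L_iff g by simp
    then show "g \<in> L \<and> \<rho> g = \<one>\<^bsub>E\<^esub>" using e t_L by simp
  qed
qed

lemma \<gamma>_discrete:
  assumes g: "g \<in> carrier G"
  shows "openin (subtopology TP (\<gamma> ` carrier G)) {\<gamma> g}"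
proof -
  obtain V where V: "openin TE V" "\<one>\<^bsub>E\<^esub> \<in> V" "\<forall>l\<in>L. \<rho> l \<in> V \<longrightarrow> \<rho> l = \<one>\<^bsub>E\<^esub>"
    using rho_discrete by blast
  \<comment> \<open>If \<open>h = g u\<close> with \<open>u \<in> L\<close>, then
    \<open>t h L\<close> is \<open>\<Delta> g (\<rho> u)\<close> times \<open>t g L\<close>, and
    \<open>?\<phi>\<close> recovers \<open>\<rho> u\<close> from it.\<close>
  let ?\<phi> = "\<lambda>v. \<Delta> (inv g) (v \<otimes>\<^bsub>E\<^esub> inv\<^bsub>E\<^esub> (t g L))"
  have tg: "topological_group E TE" using lcE by (simp add: locally_compact_group_def)
  have \<phi>: "continuous_map TE TE ?\<phi>"
    using continuous_map_compose[OF continuous_right_translation[OF tg, of "inv\<^bsub>E\<^esub> (t g L)"]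
        Delta_continuous[of "inv g"]] g by (simp add: o_def)
  let ?W = "{v \<in> topspace TE. ?\<phi> v \<in> V}"
  have W: "openin TE ?W" using openin_continuous_map_preimage[OF \<phi> V(1)] .
  let ?N = "?W \<times> {x \<in> carrier S. x L = g <# L}"
  have N: "openin TP ?N"
    using W openin_TS_agree1[OF L_in] by (simp add: openin_prod_Times_iff)
  have gN: "\<gamma> g \<in> ?N"
    using g V(2) by (simp add: \<gamma>_def)
  \<comment> \<open>The second factor of \<open>?N\<close> puts \<open>inv g \<otimes> h\<close>
    into \<open>L\<close> and the first makes its \<open>\<rho>\<close>-image trivial, so only
    finitely many points remain.\<close>
  have "?N \<inter> \<gamma> ` carrier G \<subseteq> (\<lambda>u. \<gamma> (g \<otimes> u)) ` {l \<in> L. \<rho> l = \<one>\<^bsub>E\<^esub>}"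
  proof
    fix a assume "a \<in> ?N \<inter> \<gamma> ` carrier G"
    then obtain h where h: "h \<in> carrier G" "a = \<gamma> h" "?\<phi> (t h L) \<in> V" "h <# L = g <# L"
      by (auto simp: \<gamma>_def)
    let ?u = "inv g \<otimes> h"
    have hu: "h = g \<otimes> ?u" using g h by (simp flip: m_assoc)
    have u: "?u \<in> L"
      using l_coset_eq_iff[OF L_subgroup g h(1)] h(4) by simp
    then have uL: "?u <# L = L" using act_L_iff g h by simp
    have "t h L = \<Delta> g (\<rho> ?u) \<otimes>\<^bsub>E\<^esub> t g L"
      using t_mult[of g ?u L] g h(1) hu uL t_L[OF u] by simp
    then have "t h L \<otimes>\<^bsub>E\<^esub> inv\<^bsub>E\<^esub> (t g L) = \<Delta> g (\<rho> ?u)"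
      using g u by (simp add: E.m_assoc)
    then have "?\<phi> (t h L) = \<rho> ?u"
      using Delta_act[of "inv g" g "\<rho> ?u"] g u by simp
    then have "\<rho> ?u = \<one>\<^bsub>E\<^esub>" using V(3) u h(3) by simp
    then show "a \<in> (\<lambda>u. \<gamma> (g \<otimes> u)) ` {l \<in> L. \<rho> l = \<one>\<^bsub>E\<^esub>}"
      using u hu h(2) by (intro image_eqI[of _ _ ?u]) simp_all
  qed
  then have "finite (?N \<inter> \<gamma> ` carrier G)"
    by (rule finite_subset) (simp add: rho_kernel)
  moreover have "Hausdorff_space TP" using locally_compact_group_P by (simp add: locally_compact_group_def)
  moreover have "\<gamma> ` carrier G \<subseteq> topspace TP" by (auto simp: \<gamma>_def)
  ultimately show ?thesis
    using openin_singleton_if_finite_nbhd[OF _ _ _ N gN] g by blast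
qed

text \<open>First move \<open>x L\<close> to \<open>L\<close> by an element of \<open>\<Gamma>\<close>; then elements of \<open>L\<close> act on the \<open>E\<close>-component by
  right multiplication with \<open>\<rho>\<close>.\<close>

lemma \<gamma>_cover:
  assumes M: "\<forall>v\<in>carrier E. \<exists>l\<in>L. v \<otimes>\<^bsub>E\<^esub> \<rho> l \<in> M" and a: "a \<in> carrier P"
  shows "\<exists>h\<in>\<gamma> ` carrier G. a \<otimes>\<^bsub>P\<^esub> h \<in> M \<times> K"
proof -
  interpret P: group P by (rule group_P)
  obtain v x where vx: "a = (v, x)" "v \<in> carrier E" "x \<in> carrier S" using a by auto
  obtain g where g: "g \<in> carrier G" "(inv\<^bsub>S\<^esub> x) L = g <# L"
    using coset_obtain[of "(inv\<^bsub>S\<^esub> x) L"] vx by auto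
  have \<gamma>c: "\<gamma> g \<in> carrier P" if "g \<in> carrier G" for g using that by (simp add: \<gamma>_def)
  obtain w y where wy: "a \<otimes>\<^bsub>P\<^esub> \<gamma> g = (w, y)" by fastforce
  have wyP: "(w, y) \<in> carrier P" using wy P.m_closed[OF a \<gamma>c[OF g(1)]] by simp
  have "y = x \<otimes>\<^bsub>S\<^esub> lam g" using wy vx by (simp add: \<gamma>_def)
  then have yL: "y L = L" using g inv_S_apply(2)[OF vx(3) L_in] by simp
  have wy': "w \<in> carrier E" "y \<in> carrier S" using wyP by auto
  obtain l where l: "l \<in> L" "w \<otimes>\<^bsub>E\<^esub> \<rho> l \<in> M" using M wy' by blast
  have "(w, y) \<otimes>\<^bsub>P\<^esub> \<gamma> l = (w \<otimes>\<^bsub>E\<^esub> \<rho> l, y \<otimes>\<^bsub>S\<^esub> lam l)"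
    using l wy' yL act_L_iff[of l] by (simp add: \<gamma>_def t_L)
  moreover have "y \<otimes>\<^bsub>S\<^esub> lam l \<in> K"
    using l wy' yL act_L_iff[of l] by (simp add: K_def)
  ultimately have "(w, y) \<otimes>\<^bsub>P\<^esub> \<gamma> l \<in> M \<times> K" using l by simp
  moreover have "\<gamma> (g \<otimes> l) = \<gamma> g \<otimes>\<^bsub>P\<^esub> \<gamma> l"
    using g(1) Lc[OF l(1)] by (rule hom_mult[OF \<gamma>_hom])
  then have "(w, y) \<otimes>\<^bsub>P\<^esub> \<gamma> l = a \<otimes>\<^bsub>P\<^esub> \<gamma> (g \<otimes> l)"
    using P.m_assoc[OF a \<gamma>c[OF g(1)] \<gamma>c[OF Lc[OF l(1)]]] wy by (simp only:)
  ultimately have "a \<otimes>\<^bsub>P\<^esub> \<gamma> (g \<otimes> l) \<in> M \<times> K" by (simp only:)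
  then show ?thesis
    by (rule bexI) (use g l in simp)
qed

lemma \<gamma>_embedding: "virtual_uniform_lattice_embedding G P TP \<gamma>"
  unfolding virtual_uniform_lattice_embedding_def uniform_lattice_def
proof (intro conjI ballI)
  interpret \<gamma>: group_hom G P \<gamma>
    using \<gamma>_hom group_P group_axioms by (simp add: group_hom_def group_hom_axioms_def)
  show "\<gamma> \<in> hom G P" by (rule \<gamma>_hom)
  show "finite {x \<in> carrier G. \<gamma> x = \<one>\<^bsub>P\<^esub>}" by (rule \<gamma>_kernel)
  show sub: "subgroup (\<gamma> ` carrier G) P" by (rule \<gamma>.img_is_subgroup)
  show "openin (subtopology TP (\<gamma> ` carrier G)) {x}" if "x \<in> \<gamma> ` carrier G" for x
    using that \<gamma>_discrete by blast
  obtain M where M: "compactin TE M" "\<forall>v\<in>carrier E. \<exists>l\<in>L. v \<otimes>\<^bsub>E\<^esub> \<rho> l \<in> M"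
    using rho_cocompact by blast
  have "compactin TP (M \<times> K)"
    using M compactin_K by (simp add: compactin_Times)
  then show "compact_space (coset_space_topology P TP (\<gamma> ` carrier G))"
    using locally_compact_group_P sub \<gamma>_cover[OF M(2)]
    by (intro compact_coset_spaceI) (auto simp: locally_compact_group_def)
qed

end

text \<open>The compact set is enlarged to the union of its right translates by
  \<open>\<rho> r\<close>, with \<open>r\<close> running over finitely many representatives of
  \<open>K\<close> modulo \<open>H\<close>.\<close>

lemma (in group) cocompact_finite_index_subgroup:
  fixes E :: "('e, 'f) monoid_scheme"
  assumes K: "subgroup K G" and H: "finite_index_subgroup G H K"
    and \<rho>: "\<rho> \<in> hom (G\<lparr>carrier := K\<rparr>) E" and E: "topological_group E T"
    and M: "compactin T M" "\<And>v. v \<in> carrier E \<Longrightarrow> \<exists>h\<in>\<rho> ` K. v \<otimes>\<^bsub>E\<^esub> h \<in> M"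
  shows "\<exists>M. compactin T M \<and> (\<forall>v\<in>carrier E. \<exists>h\<in>H. v \<otimes>\<^bsub>E\<^esub> \<rho> h \<in> M)"
proof -
  interpret E: group E using E by (simp add: topological_group_def)
  have Hs: "subgroup H G" "H \<subseteq> K" using H by (auto simp: finite_index_subgroup_def)
  have \<rho>c: "\<rho> k \<in> carrier E" if "k \<in> K" for k
    using \<rho> that by (auto simp: hom_def)
  have \<rho>m: "\<rho> (k \<otimes> l) = \<rho> k \<otimes>\<^bsub>E\<^esub> \<rho> l" if "k \<in> K" "l \<in> K" for k l
    using \<rho> that by (auto simp: hom_def)
  have Kc: "K \<subseteq> carrier G" using K subgroup.subset by blast
  obtain R where R: "finite R" "R \<subseteq> K" "\<forall>k\<in>K. \<exists>r\<in>R. k <# H = r <# H"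
    using finite_index_representatives[OF H Kc] by meson
  let ?M = "\<Union>r\<in>R. (\<lambda>x. x \<otimes>\<^bsub>E\<^esub> \<rho> r) ` M"
  have "compactin T ((\<lambda>x. x \<otimes>\<^bsub>E\<^esub> \<rho> r) ` M)" if "r \<in> R" for r
    using continuous_right_translation[OF E \<rho>c] R(2) that M(1) image_compactin by blast
  then have "compactin T ?M"
    using R(1) by (intro compactin_Union) auto
  moreover have "\<exists>h\<in>H. v \<otimes>\<^bsub>E\<^esub> \<rho> h \<in> ?M" if v: "v \<in> carrier E" for v
  proof -
    obtain k where k: "k \<in> K" "v \<otimes>\<^bsub>E\<^esub> \<rho> k \<in> M" using M(2)[OF v] by blast
    have ki: "inv k \<in> K" using k(1) by (rule subgroup.m_inv_closed[OF K])
    \<comment> \<open>The representative is taken for \<open>inv k\<close> because equality of left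
      cosets then says \<open>k \<otimes> r \<in> H\<close>.\<close>
    obtain r where r: "r \<in> R" "inv k <# H = r <# H" using R(3) ki by blast
    have rK: "r \<in> K" "r \<in> carrier G" "k \<in> carrier G" using r R k Kc by auto
    have kr: "k \<otimes> r \<in> H"
      using l_coset_eq_iff[OF Hs(1), of "inv k" r] rK r(2) by simp
    have "v \<otimes>\<^bsub>E\<^esub> \<rho> (k \<otimes> r) = v \<otimes>\<^bsub>E\<^esub> \<rho> k \<otimes>\<^bsub>E\<^esub> \<rho> r"
      using \<rho>m[OF k(1) rK(1)] v \<rho>c k(1) rK(1) by (simp add: E.m_assoc)
    then have "v \<otimes>\<^bsub>E\<^esub> \<rho> (k \<otimes> r) \<in> ?M" using k(2) r(1) by auto
    then show ?thesis using kr by blast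
  qed
  ultimately have "compactin T ?M \<and> (\<forall>v\<in>carrier E. \<exists>h\<in>H. v \<otimes>\<^bsub>E\<^esub> \<rho> h \<in> ?M)" by blast
  then show ?thesis by (rule exI)
qed

section \<open>Assembly from a Hecke pair and an engulfing triple\<close>

theorem theorem5p2:
  fixes \<Gamma> :: "('g, 'b) monoid_scheme" and \<Lambda> :: "'g set"
    and E :: "('e, 'f) monoid_scheme" and TE :: "'e topology"
    and \<rho> :: "'g \<Rightarrow> 'e" and \<Delta> :: "'g \<Rightarrow> 'e \<Rightarrow> 'e"
  assumes "finitely_generated_group \<Gamma>"
    and "hecke_pair \<Gamma> \<Lambda>"
    and "engulfing_triple \<Gamma> \<Lambda> E TE \<rho> \<Delta>"
  shows "\<exists>(G :: ('e \<times> ('g set \<Rightarrow> 'g set)) monoid) (TG :: ('e \<times> ('g set \<Rightarrow> 'g set)) topology)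
           (\<gamma> :: 'g \<Rightarrow> 'e \<times> ('g set \<Rightarrow> 'g set)) (p :: 'e \<Rightarrow> 'e \<times> ('g set \<Rightarrow> 'g set))
           (q :: 'e \<times> ('g set \<Rightarrow> 'g set) \<Rightarrow> ('g set \<Rightarrow> 'g set)) \<Lambda>\<^sub>0.
           locally_compact_group G TG \<and>
           virtual_uniform_lattice_embedding \<Gamma> G TG \<gamma> \<and>
           finite_index_subgroup \<Gamma> \<Lambda>\<^sub>0 \<Lambda> \<and>
           p \<in> hom E G \<and> inj_on p (carrier E) \<and>
           q \<in> hom G (schlichting_group \<Gamma> \<Lambda>\<^sub>0) \<and>
           q ` carrier G = carrier (schlichting_group \<Gamma> \<Lambda>\<^sub>0) \<and>
           p ` carrier E = kernel G (schlichting_group \<Gamma> \<Lambda>\<^sub>0) q \<and>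
           embedding_map TE TG p \<and>
           quotient_map TG (schlichting_topology \<Gamma> \<Lambda>\<^sub>0) q \<and>
           (\<forall>g\<in>carrier \<Gamma>. schlichting_map \<Gamma> \<Lambda>\<^sub>0 g = q (\<gamma> g)) \<and>
           (\<forall>g\<in>carrier \<Gamma>. \<forall>v\<in>carrier E.
              p (\<Delta> g v) = \<gamma> g \<otimes>\<^bsub>G\<^esub> p v \<otimes>\<^bsub>G\<^esub> inv\<^bsub>G\<^esub> (\<gamma> g))"
proof -
  interpret \<Gamma>: group \<Gamma>
    using assms(2) by (simp add: hecke_pair_def)
  obtain A where A: "finite A" "A \<subseteq> carrier \<Gamma>" "generate \<Gamma> A = carrier \<Gamma>"
    using assms(1) by (auto simp: finitely_generated_group_def)
  have \<Lambda>: "subgroup \<Lambda> \<Gamma>"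
    using assms(2) by (simp add: hecke_pair_def)
  have lcE: "locally_compact_group E TE"
    and \<rho>: "\<rho> \<in> hom (\<Gamma>\<lparr>carrier := \<Lambda>\<rparr>) E" "finite {l \<in> \<Lambda>. \<rho> l = \<one>\<^bsub>E\<^esub>}"
      "uniform_lattice E TE (\<rho> ` \<Lambda>)"
    and \<Delta>: "\<forall>g\<in>carrier \<Gamma>. \<Delta> g \<in> top_aut E TE"
      "\<forall>g\<in>carrier \<Gamma>. \<forall>h\<in>carrier \<Gamma>. \<forall>v\<in>carrier E. \<Delta> (g \<otimes>\<^bsub>\<Gamma>\<^esub> h) v = \<Delta> g (\<Delta> h v)"
      "\<forall>h\<in>\<Lambda>. \<forall>v\<in>carrier E. \<Delta> h v = \<rho> h \<otimes>\<^bsub>E\<^esub> v \<otimes>\<^bsub>E\<^esub> inv\<^bsub>E\<^esub> (\<rho> h)"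
    and ex: "\<forall>g\<in>carrier \<Gamma>. \<exists>Lg. finite_index_subgroup \<Gamma> Lg \<Lambda> \<and>
        (\<forall>h\<in>Lg. g \<otimes>\<^bsub>\<Gamma>\<^esub> h \<otimes>\<^bsub>\<Gamma>\<^esub> inv\<^bsub>\<Gamma>\<^esub> g \<in> \<Lambda> \<and>
                 \<Delta> g (\<rho> h) = \<rho> (g \<otimes>\<^bsub>\<Gamma>\<^esub> h \<otimes>\<^bsub>\<Gamma>\<^esub> inv\<^bsub>\<Gamma>\<^esub> g))"
    using assms(3)
    by (simp_all add: engulfing_triple_def aut_action_def virtual_uniform_lattice_embedding_def)
  have tgE: "topological_group E TE" using lcE by (simp add: locally_compact_group_def)
  interpret E: group E using tgE by (simp add: topological_group_def)
  obtain Lg where Lg: "\<And>g. g \<in> carrier \<Gamma> \<Longrightarrow> finite_index_subgroup \<Gamma> (Lg g) \<Lambda>"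
      "\<And>g h. g \<in> carrier \<Gamma> \<Longrightarrow> h \<in> Lg g \<Longrightarrow> \<Delta> g (\<rho> h) = \<rho> (g \<otimes>\<^bsub>\<Gamma>\<^esub> h \<otimes>\<^bsub>\<Gamma>\<^esub> inv\<^bsub>\<Gamma>\<^esub> g)"
    using ex by metis
  \<comment> \<open>This will be \<open>\<Lambda>\<^sub>0\<close>: on it the compatibility relation
    holds for every generator.\<close>
  define L where "L = \<Lambda> \<inter> (\<Inter>a\<in>A. Lg a)"
  have L: "finite_index_subgroup \<Gamma> L \<Lambda>"
    unfolding L_def using \<Gamma>.finite_index_subgroup_INT[OF A(1) \<Lambda>] Lg(1) A(2) by blast
  then have L_sub: "subgroup L \<Gamma>" "L \<subseteq> \<Lambda>" by (auto simp: finite_index_subgroup_def)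
  \<comment> \<open>Multiplicativity makes \<open>\<Delta> \<one>\<close> idempotent, and an
    injective idempotent is the identity.\<close>
  have \<Delta>1: "\<Delta> \<one>\<^bsub>\<Gamma>\<^esub> v = v" if v: "v \<in> carrier E" for v
  proof -
    have "bij_betw (\<Delta> \<one>\<^bsub>\<Gamma>\<^esub>) (carrier E) (carrier E)"
      using \<Delta>(1) by (simp add: top_aut_def)
    moreover have "\<Delta> \<one>\<^bsub>\<Gamma>\<^esub> (\<Delta> \<one>\<^bsub>\<Gamma>\<^esub> v) = \<Delta> \<one>\<^bsub>\<Gamma>\<^esub> v"
      using \<Delta>(2) v by (metis \<Gamma>.one_closed \<Gamma>.l_one)
    ultimately show ?thesis
      using v by (metis bij_betw_apply bij_betw_imp_inj_on inj_onD)
  qed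
  interpret finite_orbit_subgroup \<Gamma> L
  proof (intro finite_orbit_subgroup.intro finite_orbit_subgroup_axioms.intro)
    fix g assume "g \<in> carrier \<Gamma>"
    \<comment> \<open>The orbits under the larger group \<open>\<Lambda>\<close> are already
      finite.\<close>
    then have "finite {l <#\<^bsub>\<Gamma>\<^esub> (g <#\<^bsub>\<Gamma>\<^esub> L) |l. l \<in> \<Lambda>}"
      by (rule hecke_pair_finite_orbit[OF assms(2) L])
    then show "finite {l <#\<^bsub>\<Gamma>\<^esub> (g <#\<^bsub>\<Gamma>\<^esub> L) |l. l \<in> L}"
      by (rule rev_finite_subset) (use L_sub in blast)
  qed (fact \<Gamma>.group_axioms L_sub(1))+
  have \<rho>_in: "\<rho> l \<in> carrier E" if "l \<in> L" for l
    using \<rho>(1) L_sub(2) that by (auto simp: hom_def)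
  interpret engulfed_group \<Gamma> L E \<rho> \<Delta>
  proof
    show "\<rho> \<in> hom (\<Gamma>\<lparr>carrier := L\<rparr>) E"
      using \<rho>(1) L_sub(2) by (auto simp: hom_def)
    show "\<Delta> g \<in> hom E E" if "g \<in> carrier \<Gamma>" for g
      using \<Delta>(1) that by (simp add: top_aut_def)
    fix g assume g: "g \<in> carrier \<Gamma>"
    show "\<exists>F. finite F \<and> F \<subseteq> lcosets\<^bsub>\<Gamma>\<^esub> L \<and> (\<forall>u\<in>carrier \<Gamma>. (\<forall>C\<in>F. u <#\<^bsub>\<Gamma>\<^esub> C = C) \<longrightarrow>
        u \<in> L \<and> inv\<^bsub>\<Gamma>\<^esub> g \<otimes>\<^bsub>\<Gamma>\<^esub> u \<otimes>\<^bsub>\<Gamma>\<^esub> g \<in> L \<and>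
        \<Delta> g (\<rho> (inv\<^bsub>\<Gamma>\<^esub> g \<otimes>\<^bsub>\<Gamma>\<^esub> u \<otimes>\<^bsub>\<Gamma>\<^esub> g)) = \<rho> u)"
    proof (rule compatible_on_generate[of A "carrier E"])
      show "\<Delta> a (\<rho> h) = \<rho> (a \<otimes>\<^bsub>\<Gamma>\<^esub> h \<otimes>\<^bsub>\<Gamma>\<^esub> inv\<^bsub>\<Gamma>\<^esub> a)" if "a \<in> A" "h \<in> L" for a h
        using Lg(2) that A(2) unfolding L_def by blast
      show "g \<in> generate \<Gamma> A" using g A(3) by simp
    qed (use A(2) \<Delta>(2) \<Delta>1 \<rho>_in in auto)
  qed (use \<Delta> \<Delta>1 L_sub in auto)
  interpret engulfed_lattice \<Gamma> L E \<rho> \<Delta> TE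
  proof
    show "locally_compact_group E TE" by (rule lcE)
    show "continuous_map TE TE (\<Delta> g)" if "g \<in> carrier \<Gamma>" for g
      using \<Delta>(1) that by (simp add: top_aut_def homeomorphic_imp_continuous_map)
    show "finite {l \<in> L. \<rho> l = \<one>\<^bsub>E\<^esub>}"
      using \<rho>(2) by (rule rev_finite_subset) (use L_sub in blast)
    have one: "\<one>\<^bsub>E\<^esub> \<in> \<rho> ` \<Lambda>"
      using \<rho>(3) by (simp add: uniform_lattice_def subgroup.one_closed)
    then have "openin (subtopology TE (\<rho> ` \<Lambda>)) {\<one>\<^bsub>E\<^esub>}"
      using \<rho>(3) unfolding uniform_lattice_def by blast
    \<comment> \<open>This \<open>V\<close> isolates the identity in the image of
      \<open>\<Lambda>\<close>, hence also in the smaller image of \<open>L\<close>.\<close>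
    then obtain V where "openin TE V" "{\<one>\<^bsub>E\<^esub>} = V \<inter> \<rho> ` \<Lambda>"
      by (auto simp: openin_subtopology)
    then show "\<exists>V. openin TE V \<and> \<one>\<^bsub>E\<^esub> \<in> V \<and> (\<forall>l\<in>L. \<rho> l \<in> V \<longrightarrow> \<rho> l = \<one>\<^bsub>E\<^esub>)"
      using L_sub(2) by blast
    \<comment> \<open>Cocompactness of the image of \<open>\<Lambda>\<close> yields a compact set
      meeting all its cosets, and finite index passes this on to \<open>L\<close>.\<close>
    obtain M where "compactin TE M" "\<And>v. v \<in> carrier E \<Longrightarrow> \<exists>h\<in>\<rho> ` \<Lambda>. v \<otimes>\<^bsub>E\<^esub> h \<in> M"
      using compact_coset_spaceE[OF lcE] \<rho>(3) unfolding uniform_lattice_def by metis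
    then show "\<exists>M. compactin TE M \<and> (\<forall>v\<in>carrier E. \<exists>l\<in>L. v \<otimes>\<^bsub>E\<^esub> \<rho> l \<in> M)"
      by (rule \<Gamma>.cocompact_finite_index_subgroup[OF \<Lambda> L \<rho>(1) tgE])
  qed
  have "q ` carrier P = carrier S" if "q = snd" for q
    using that E.one_closed by force
  moreover have "inj_on (\<lambda>v. (v, \<one>\<^bsub>S\<^esub>)) (carrier E)"
    by (simp add: inj_on_def)
  moreover have "\<forall>g\<in>carrier \<Gamma>. schlichting_map \<Gamma> L g = snd (\<gamma> g)"
    by (simp add: \<gamma>_def)
  ultimately show ?thesis
    using locally_compact_group_P \<gamma>_embedding L inclusion_hom projection_hom
      kernel_projection[symmetric] embedding_inclusion quotient_projection \<gamma>_conj
    by (intro exI[of _ P] exI[of _ TP] exI[of _ \<gamma>] exI[of _ "\<lambda>v. (v, \<one>\<^bsub>S\<^esub>)"] exI[of _ snd]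
        exI[of _ L]) simp
qed

end
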